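(* Let $n\ge2$ be an integer and $1<p\le2$. Then $$\mathcal{L}(\ell_1,\overset{n-1}{\ldots},\ell_1,\ell_p;\mathbb{K})=\Pi_{(r_n;r_n,\ldots,r_n)}(\ell_1,\overset{n-1}{\ldots},\ell_1,\ell_p;\mathbb{K})$$ for every $1\le r_n\le\frac{2^{n-1}}{2^{n-1}-1}$, where $\ell_1$ appears $n-1$ times.
   Context: Banach spaces are over $\mathbb{K}=\mathbb{R}$ or $\mathbb{C}$; $E'$ is the topological dual of $E$ and $B_{E'}$ its closed unit ball. $\mathcal{L}(E_1,\ldots,E_n;\mathbb{K})$ is the space of continuous $n$-linear forms on $E_1\times\cdots\times E_n$. For a finite family, $\|(x_j)\|_{\ell_p^w(E)}=\sup_{\varphi\in B_{E'}}(\sum_j|\varphi(x_j)|^p)^{1/p}$. For $0<p,p_1,\ldots,p_n<\infty$ with $\frac1p\le\frac1{p_1}+\cdots+\frac1{p_n}$, $\Pi_{(p;p_1,\ldots,p_n)}(E_1,\ldots,E_n;\mathbb{K})$ is the space of absolutely $(p;p_1,\ldots,p_n)$-summing $n$-linear forms, i.e. those $A\in\mathcal{L}(E_1,\ldots,E_n;\mathbb{K})$ for which there is $C>0$ with $\big(\sum_{j=1}^m|A(x_j^1,\ldots,x_j^n)|^p\big)^{1/p}\le C\prod_{i=1}^n\|(x_j^i)_{j=1}^m\|_{\ell_{p_i}^w(E_i)}$ for all finite families $x_1^i,\ldots,x_m^i\in E_i$, $i=1,\ldots,n$. *)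

theory Defs
  imports "HOL-Analysis.Analysis"
begin

text \<open>
  Normed spaces over a scalar field \<open>'k\<close> (used below for \<open>'k = real\<close> and \<open>'k = complex\<close>) are
  given by a carrier with its operations, since the exponent of a sequence space and the
  number of factors of a product of spaces are variables of the statement.
\<close>

record ('k, 'v) nspace =
  car :: "'v set"
  vadd :: "'v \<Rightarrow> 'v \<Rightarrow> 'v"
  vscale :: "'k \<Rightarrow> 'v \<Rightarrow> 'v"
  vnorm :: "'v \<Rightarrow> real"

definition norm_topology :: "('k::real_normed_field, 'v) nspace \<Rightarrow> 'v topology" where
  "norm_topology E =
     Metric_space.mtopology (car E) (\<lambda>x y. vnorm E (vadd E x (vscale E (- 1) y)))"

definition lp_space :: "real \<Rightarrow> ('k::real_normed_field, nat \<Rightarrow> 'k) nspace" where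
  "lp_space p =
     \<lparr> car = {x. summable (\<lambda>k. norm (x k) powr p)},
       vadd = (\<lambda>x y k. x k + y k),
       vscale = (\<lambda>c x k. c * x k),
       vnorm = (\<lambda>x. (\<Sum>k. norm (x k) powr p) powr (1 / p)) \<rparr>"

definition dual_space :: "('k::real_normed_field, 'v) nspace \<Rightarrow> ('v \<Rightarrow> 'k) set" where
  "dual_space E =
     {\<phi>. \<phi> \<in> extensional (car E) \<and>
         (\<forall>x\<in>car E. \<forall>y\<in>car E. \<phi> (vadd E x y) = \<phi> x + \<phi> y) \<and>
         (\<forall>c. \<forall>x\<in>car E. \<phi> (vscale E c x) = c * \<phi> x) \<and>
         continuous_map (norm_topology E) euclidean \<phi>}"

definition dual_ball :: "('k::real_normed_field, 'v) nspace \<Rightarrow> ('v \<Rightarrow> 'k) set" where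
  "dual_ball E = {\<phi> \<in> dual_space E. \<forall>x\<in>car E. vnorm E x \<le> 1 \<longrightarrow> norm (\<phi> x) \<le> 1}"

text \<open>The weak norm of the finite family \<open>x 0, \<dots>, x (m - 1)\<close>.\<close>

definition weak_norm ::
    "real \<Rightarrow> ('k::real_normed_field, 'v) nspace \<Rightarrow> nat \<Rightarrow> (nat \<Rightarrow> 'v) \<Rightarrow> real" where
  "weak_norm p E m x = (SUP \<phi>\<in>dual_ball E. (\<Sum>j<m. norm (\<phi> (x j)) powr p) powr (1 / p))"

text \<open>
  An \<open>n\<close>-linear form is a function on the product of the carriers of \<open>E 0, \<dots>, E (n - 1)\<close>;
  extensionality makes equality of forms the same as equality on that product.
\<close>

definition multilinear_forms ::
    "nat \<Rightarrow> (nat \<Rightarrow> ('k::real_normed_field, 'v) nspace) \<Rightarrow> ((nat \<Rightarrow> 'v) \<Rightarrow> 'k) set" where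
  "multilinear_forms n E =
     {A. A \<in> extensional (\<Pi>\<^sub>E i\<in>{..<n}. car (E i)) \<and>
         (\<forall>x \<in> (\<Pi>\<^sub>E i\<in>{..<n}. car (E i)). \<forall>i<n.
            (\<forall>u\<in>car (E i). \<forall>v\<in>car (E i).
               A (x(i := vadd (E i) u v)) = A (x(i := u)) + A (x(i := v))) \<and>
            (\<forall>c. \<forall>u\<in>car (E i). A (x(i := vscale (E i) c u)) = c * A (x(i := u)))) \<and>
         continuous_map (product_topology (\<lambda>i. norm_topology (E i)) {..<n}) euclidean A}"

text \<open>
  The absolutely \<open>(p; ps 0, \<dots>, ps (n - 1))\<close>-summing forms, for positive exponents with
  \<open>1 / p \<le> (\<Sum>i<n. 1 / ps i)\<close>.
  Here \<open>x j i\<close> is the \<open>j\<close>-th vector of the family in the \<open>i\<close>-th space.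
\<close>

definition summing_forms ::
    "real \<Rightarrow> (nat \<Rightarrow> real) \<Rightarrow> nat \<Rightarrow> (nat \<Rightarrow> ('k::real_normed_field, 'v) nspace)
       \<Rightarrow> ((nat \<Rightarrow> 'v) \<Rightarrow> 'k) set" where
  "summing_forms p ps n E =
     {A \<in> multilinear_forms n E.
        \<exists>C>0. \<forall>m x. (\<forall>j<m. x j \<in> (\<Pi>\<^sub>E i\<in>{..<n}. car (E i))) \<longrightarrow>
          (\<Sum>j<m. norm (A (x j)) powr p) powr (1 / p)
            \<le> C * (\<Prod>i<n. weak_norm (ps i) (E i) m (\<lambda>j. x j i))}"

text \<open>The family of \<open>n - 1\<close> copies of \<open>\<ell>\<^sub>1\<close> followed by one copy of \<open>\<ell>\<^sub>p\<close>.\<close>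

definition l1_lp_family :: "nat \<Rightarrow> real \<Rightarrow> nat \<Rightarrow> ('k::real_normed_field, nat \<Rightarrow> 'k) nspace" where
  "l1_lp_family n p i = (if i < n - 1 then lp_space 1 else lp_space p)"

end

theory Submission
  imports Defs
begin

text \<open>
  Every form on \<open>\<ell>\<^sub>1 \<times> \<dots> \<times> \<ell>\<^sub>1 \<times> E\<close> turns out to be \<open>(r; r, \<dots>, r)\<close>-summing for all \<open>1 \<le> r \<le> 2\<close>. Expanding
  an \<open>\<ell>\<^sub>1\<close>-argument along the unit vectors reduces the claim to a diagonal inequality: if \<open>x\<^sub>j\<close> in
  \<open>\<ell>\<^sub>1\<close> has weak \<open>r\<close>-norm at most \<open>1\<close> and \<open>(\<Sum>j. |z\<^sub>j(k)|\<^sup>r) \<le> 1\<close> for every \<open>k\<close>, then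
  \<open>\<Sum>j. |\<Sum>k. x\<^sub>j(k) z\<^sub>j(k)|\<^sup>r \<le> C\<close>. The left-hand side only involves the terms \<open>i = j\<close> of the square
  functions \<open>(\<Sum>i. |\<Sum>k. x\<^sub>j(k) z\<^sub>i(k)|\<^sup>2)\<^bsup>1/2\<^esup>\<close>, and \<open>|z|\<^sup>2 \<le> |z|\<^sup>r\<close> for \<open>|z| \<le> 1\<close>, so it is enough to
  extend the operators \<open>x\<^sub>j\<close> from scalar to Hilbert space valued sequences, which is Grothendieck's
  theorem in its little form. To prove that, replace \<open>z\<^sub>i\<close> by the Rademacher sums
  \<open>X(k) = \<Sum>i. \<epsilon>\<^sub>i z\<^sub>i(k)\<close> and truncate them at a fixed level. The bounded part is controlled by the weak
  norm; the remainder is small in \<open>L\<^sub>2\<close>, by the fourth moment, and is absorbed by the best constant.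
\<close>

section \<open>Moments of Rademacher sums\<close>

lemma sum_lessThan_add:
  fixes f :: "nat \<Rightarrow> 'a::comm_monoid_add"
  shows "(\<Sum>i<a + b. f i) = (\<Sum>i<a. f i) + (\<Sum>i<b. f (a + i))"
  by (induction b) (auto simp: add.assoc)

lemma norm_add_diff_power2:
  fixes u v :: "'a::real_inner"
  shows "norm (u + v)^2 + norm (u - v)^2 = 2 * norm u^2 + 2 * norm v^2"
  by (simp add: power2_norm_eq_inner algebra_simps inner_commute)

text \<open>In the sum the terms of odd degree in \<open>u \<bullet> v\<close> cancel, and
  Cauchy-Schwarz bounds the surviving \<open>8 * (u \<bullet> v)^2\<close>. The coefficients 2, 12,
  2 are those of the scalar identity.\<close>

lemma norm_add_diff_power4:
  fixes u v :: "'a::real_inner"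
  shows "norm (u + v)^4 + norm (u - v)^4
    \<le> 2 * norm u^4 + 12 * norm u^2 * norm v^2 + 2 * norm v^4"
proof -
  have p4: "t^4 = (t^2)^2" for t :: real by simp
  have 1: "norm (u + v)^2 = norm u^2 + norm v^2 + 2 * (u \<bullet> v)"
    and 2: "norm (u - v)^2 = norm u^2 + norm v^2 - 2 * (u \<bullet> v)"
    by (simp_all add: power2_norm_eq_inner algebra_simps inner_commute)
  have "norm (u + v)^4 + norm (u - v)^4 = 2 * (norm u^2 + norm v^2)^2 + 8 * (u \<bullet> v)^2"
    unfolding p4 1 2 by (simp add: power2_eq_square algebra_simps)
  also have "(u \<bullet> v)^2 \<le> norm u^2 * norm v^2"
    using Cauchy_Schwarz_ineq2[of u v] by (metis abs_ge_zero power2_abs power_mono power_mult_distrib)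
  finally show ?thesis
    unfolding p4[of "norm u"] p4[of "norm v"] by (simp add: power2_eq_square algebra_simps)
qed

text \<open>The \<open>N\<close> sample points carry the uniform measure and
  \<open>e \<omega> i\<close> is the \<open>i\<close>-th sign at \<open>\<omega>\<close>; only the
  second and fourth moments are recorded. The signs are chosen before the coefficients
  \<open>a\<close>, so that one choice serves all coordinates \<open>k\<close> and all operators
  \<open>x j\<close> at once. Coefficients in a real inner product space cover real and complex
  scalars together.\<close>

lemma rademacher_moments:
  "\<exists>N>0. \<exists>e :: nat \<Rightarrow> nat \<Rightarrow> real. \<forall>a :: nat \<Rightarrow> 'a::real_inner.
     (\<Sum>\<omega><N. norm (\<Sum>i<m. e \<omega> i *\<^sub>R a i)^2) = real N * (\<Sum>i<m. norm (a i)^2) \<and>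
     (\<Sum>\<omega><N. norm (\<Sum>i<m. e \<omega> i *\<^sub>R a i)^4) \<le> 3 * real N * (\<Sum>i<m. norm (a i)^2)^2"
proof (induction m)
  case 0
  show ?case by (intro exI[of _ 1]) auto
next
  case (Suc m)
  then obtain N :: nat and e :: "nat \<Rightarrow> nat \<Rightarrow> real" where N: "N > 0"
    and e2: "\<And>a :: nat \<Rightarrow> 'a.
      (\<Sum>\<omega><N. norm (\<Sum>i<m. e \<omega> i *\<^sub>R a i)^2) = real N * (\<Sum>i<m. norm (a i)^2)"
    and e4: "\<And>a :: nat \<Rightarrow> 'a.
      (\<Sum>\<omega><N. norm (\<Sum>i<m. e \<omega> i *\<^sub>R a i)^4) \<le> 3 * real N * (\<Sum>i<m. norm (a i)^2)^2"
    by blast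
  \<comment> \<open>The sample space is doubled: both halves repeat the old signs, and the new sign
    is 1 on the first half and -1 on the second.\<close>
  define e' where "e' \<omega> i = (if i = m then if \<omega> < N then 1 else - 1 else e (\<omega> mod N) i)" for \<omega> i
  show ?case
  proof (intro exI[of _ "N + N"] exI[of _ e'] conjI allI)
    fix a :: "nat \<Rightarrow> 'a"
    define X where "X \<omega> = (\<Sum>i<m. e \<omega> i *\<^sub>R a i)" for \<omega>
    define B where "B = (\<Sum>i<m. norm (a i)^2)"
    have 1: "(\<Sum>i<Suc m. e' \<omega> i *\<^sub>R a i) = X \<omega> + a m" if "\<omega> < N" for \<omega>
      using that by (auto simp: X_def e'_def intro!: sum.cong)
    have 2: "(\<Sum>i<Suc m. e' (N + \<omega>) i *\<^sub>R a i) = X \<omega> - a m" if "\<omega> < N" for \<omega>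
      using that by (auto simp: X_def e'_def intro!: sum.cong)
    have split: "(\<Sum>\<omega><N + N. norm (\<Sum>i<Suc m. e' \<omega> i *\<^sub>R a i)^q)
        = (\<Sum>\<omega><N. norm (X \<omega> + a m)^q + norm (X \<omega> - a m)^q)" for q
      unfolding sum_lessThan_add sum.distrib using 1 2 by (auto intro!: arg_cong2[where f = "(+)"] sum.cong)
    have X2: "(\<Sum>\<omega><N. norm (X \<omega>)^2) = real N * B"
      and X4: "(\<Sum>\<omega><N. norm (X \<omega>)^4) \<le> 3 * real N * B^2"
      using e2[of a] e4[of a] by (simp_all add: X_def B_def)
    show "(\<Sum>\<omega><N + N. norm (\<Sum>i<Suc m. e' \<omega> i *\<^sub>R a i)^2) = real (N + N) * (\<Sum>i<Suc m. norm (a i)^2)"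
      unfolding split norm_add_diff_power2
      by (simp add: sum.distrib sum_distrib_left[symmetric] X2 B_def[symmetric] algebra_simps)
    have "(\<Sum>\<omega><N + N. norm (\<Sum>i<Suc m. e' \<omega> i *\<^sub>R a i)^4)
        \<le> (\<Sum>\<omega><N. 2 * norm (X \<omega>)^4 + 12 * norm (X \<omega>)^2 * norm (a m)^2 + 2 * norm (a m)^4)"
      unfolding split by (intro sum_mono norm_add_diff_power4)
    also have "\<dots> = 2 * (\<Sum>\<omega><N. norm (X \<omega>)^4) + 12 * (real N * B) * norm (a m)^2
        + 2 * real N * norm (a m)^4"
      by (simp add: sum.distrib sum_distrib_left[symmetric] sum_distrib_right[symmetric] X2)
    also have "\<dots> \<le> 2 * (3 * real N * B^2) + 12 * (real N * B) * norm (a m)^2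
        + 2 * real N * norm (a m)^4"
      using X4 by simp
    also have "\<dots> \<le> 3 * real (N + N) * (B + norm (a m)^2)^2"
    proof -
      \<comment> \<open>The right-hand side exceeds the left-hand side by exactly
        \<open>4 * real N * norm (a m)^4\<close>.\<close>
      have "real N * norm (a m)^4 \<ge> 0" by simp
      moreover have "norm (a m)^4 = (norm (a m)^2)^2" by simp
      ultimately show ?thesis by (simp add: power2_eq_square algebra_simps)
    qed
    finally show "(\<Sum>\<omega><N + N. norm (\<Sum>i<Suc m. e' \<omega> i *\<^sub>R a i)^4)
        \<le> 3 * real (N + N) * (\<Sum>i<Suc m. norm (a i)^2)^2"
      by (simp add: B_def)
  qed (use N in simp)
qed

section \<open>Comparison of \<open>r\<close>-th moments with second moments\<close>

lemma power2_powr_half: "(t^2) powr (r / 2) = t powr r" if "t \<ge> 0" for t r :: real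
  using that by (cases "t = 0") (simp_all add: powr_power powr_powr flip: powr_numeral)

text \<open>This is the lower Khinchine inequality, deduced from the second and fourth moments
  alone. With \<open>u = t^2 / s\<close>, the pointwise minorant \<open>u - u^2 / 4\<close> of
  \<open>u powr (r / 2)\<close> has mean at least \<open>1 - 3 / 4\<close>, whence the factor
  4.\<close>

lemma powr_half_mean_le:
  fixes t :: "nat \<Rightarrow> real"
  assumes r: "1 \<le> r" "r \<le> 2" and "s \<ge> 0" and t: "\<And>\<omega>. t \<omega> \<ge> 0"
    and t2: "(\<Sum>\<omega><N. t \<omega>^2) = real N * s" and t4: "(\<Sum>\<omega><N. t \<omega>^4) \<le> 3 * real N * s^2"
  shows "real N * s powr (r / 2) \<le> 4 * (\<Sum>\<omega><N. t \<omega> powr r)"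
proof (cases "s = 0")
  case True
  then show ?thesis by (simp add: sum_nonneg)
next
  case False
  with \<open>s \<ge> 0\<close> have s: "s > 0" by simp
  have pt: "s powr (r / 2) * (t \<omega>^2 / s - t \<omega>^4 / (4 * s^2)) \<le> t \<omega> powr r" for \<omega>
  proof -
    define u where "u = t \<omega>^2 / s"
    have u: "u \<ge> 0" using s by (simp add: u_def)
    \<comment> \<open>For \<open>u \<le> 1\<close> the exponent \<open>r / 2 \<le> 1\<close> gives
      already \<open>u \<le> u powr (r / 2)\<close>; beyond 1 the left-hand side never exceeds 1,
      its maximum at \<open>u = 2\<close>.\<close>
    have "u - u^2 / 4 \<le> u powr (r / 2)"
    proof (cases "u \<le> 1")
      case True
      have "u powr 1 \<le> u powr (r / 2)" using True u r by (intro powr_mono') auto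
      moreover have "u powr 1 = u" using u by simp
      ultimately show ?thesis using zero_le_power2[of u] by linarith
    next
      case False
      have "0 \<le> (u / 2 - 1)^2" by simp
      then have "u - u^2 / 4 \<le> 1" by (simp add: power2_eq_square algebra_simps)
      also have "1 \<le> u powr (r / 2)" using False r by (intro ge_one_powr_ge_zero) auto
      finally show ?thesis .
    qed
    then have "s powr (r / 2) * (u - u^2 / 4) \<le> s powr (r / 2) * u powr (r / 2)"
      by (intro mult_left_mono) auto
    also have "\<dots> = (t \<omega>^2) powr (r / 2)" using s u by (simp add: u_def powr_mult[symmetric])
    also have "\<dots> = t \<omega> powr r" by (rule power2_powr_half[OF t])
    finally show ?thesis by (simp add: u_def power_divide mult.commute)
  qed
  have "real N * s powr (r / 2) / 4 = s powr (r / 2) * (real N - (3 * real N * s^2) / (4 * s^2))"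
    using s by (simp add: field_simps)
  also have "\<dots> \<le> s powr (r / 2) * (real N * s / s - (\<Sum>\<omega><N. t \<omega>^4) / (4 * s^2))"
    using s t4 by (intro mult_left_mono diff_mono divide_right_mono) auto
  also have "\<dots> = (\<Sum>\<omega><N. s powr (r / 2) * (t \<omega>^2 / s - t \<omega>^4 / (4 * s^2)))"
    unfolding t2[symmetric] by (simp only: sum_subtractf[symmetric] sum_divide_distrib sum_distrib_left)
  also have "\<dots> \<le> (\<Sum>\<omega><N. t \<omega> powr r)" by (intro sum_mono pt)
  finally show ?thesis by simp
qed

text \<open>A Jensen inequality with the crude constant 2: \<open>u powr (r / 2) \<le> 1 + u\<close>
  is averaged over the normalised squares \<open>u = t^2 / s\<close>, whose mean is 1.\<close>

lemma sum_powr_le_mean_powr: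
  fixes t :: "nat \<Rightarrow> real"
  assumes r: "1 \<le> r" "r \<le> 2" and t: "\<And>\<omega>. t \<omega> \<ge> 0" and N: "N > 0"
  shows "(\<Sum>\<omega><N. t \<omega> powr r) \<le> 2 * real N * ((\<Sum>\<omega><N. t \<omega>^2) / real N) powr (r / 2)"
proof -
  define s where "s = (\<Sum>\<omega><N. t \<omega>^2) / real N"
  have s0: "s \<ge> 0" by (simp add: s_def sum_nonneg)
  show ?thesis
  proof (cases "s = 0")
    case True
    then have "\<forall>\<omega><N. t \<omega> = 0" using N by (auto simp: s_def sum_nonneg_eq_0_iff)
    then have "(\<Sum>\<omega><N. t \<omega> powr r) = 0" by simp
    then show ?thesis by simp
  next
    case False
    with s0 have s: "s > 0" by simp
    have "t \<omega> powr r \<le> s powr (r / 2) * (1 + t \<omega>^2 / s)" for \<omega>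
    proof -
      define u where "u = t \<omega>^2 / s"
      have u: "u \<ge> 0" using s by (simp add: u_def)
      have "u powr (r / 2) \<le> 1 + u"
      proof (cases "u \<le> 1")
        case True
        then have "u powr (r / 2) \<le> 1" using u r by (intro powr_le1) auto
        then show ?thesis using u by simp
      next
        case False
        then have "u powr (r / 2) \<le> u powr 1" using r by (intro powr_mono) auto
        then show ?thesis using u by simp
      qed
      then have "s powr (r / 2) * u powr (r / 2) \<le> s powr (r / 2) * (1 + u)"
        by (intro mult_left_mono) auto
      moreover have "s powr (r / 2) * u powr (r / 2) = (t \<omega>^2) powr (r / 2)"
        using s u by (simp add: u_def powr_mult[symmetric])
      ultimately show ?thesis using power2_powr_half[OF t] by (simp add: u_def)
    qed
    then have "(\<Sum>\<omega><N. t \<omega> powr r) \<le> (\<Sum>\<omega><N. s powr (r / 2) * (1 + t \<omega>^2 / s))"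
      by (intro sum_mono)
    also have "\<dots> = s powr (r / 2) * (real N + (\<Sum>\<omega><N. t \<omega>^2) / s)"
      by (simp add: sum_distrib_left[symmetric] sum.distrib sum_divide_distrib)
    also have "(\<Sum>\<omega><N. t \<omega>^2) / s = real N" using s N by (simp add: s_def field_simps)
    finally show ?thesis by (simp add: s_def mult.commute)
  qed
qed

section \<open>Square functions of operators into \<open>\<ell>\<^sub>r\<close>\<close>

lemma norm_add_powr_le:
  fixes a b :: "'a::real_normed_vector"
  assumes r: "1 \<le> r" "r \<le> 2"
  shows "norm (a + b) powr r \<le> 4 * (norm a powr r + norm b powr r)"
proof -
  define M where "M = max (norm a) (norm b)"
  have M: "M \<ge> 0" by (simp add: M_def le_max_iff_disj)
  have "norm (a + b) \<le> 2 * M" using norm_triangle_ineq[of a b] unfolding M_def by linarith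
  then have "norm (a + b) powr r \<le> (2 * M) powr r" using r by (intro powr_mono2) auto
  also have "\<dots> = 2 powr r * M powr r" using M by (simp add: powr_mult)
  also have "\<dots> \<le> 2 powr 2 * M powr r" using r by (intro mult_right_mono powr_mono) auto
  also have "M powr r \<le> norm a powr r + norm b powr r" by (auto simp: M_def max_def)
  finally show ?thesis by simp
qed

lemma summable_mult_bounded:
  fixes x z :: "nat \<Rightarrow> 'k::{real_normed_field,banach}"
  assumes "summable (\<lambda>k. norm (x k))" and "\<And>k. norm (z k) \<le> c"
  shows "summable (\<lambda>k. x k * z k)"
  by (rule summable_comparison_test'[where g = "\<lambda>k. norm (x k) * c" and N = 0])
    (use assms in \<open>auto simp: norm_mult intro: mult_left_mono summable_mult2\<close>)

lemma suminf_mult_scaleR: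
  fixes x z :: "nat \<Rightarrow> 'k::{real_normed_field,banach}"
  assumes "summable (\<lambda>k. norm (x k))" and "\<And>k. norm (z k) \<le> c"
  shows "(\<Sum>k. x k * (a *\<^sub>R z k)) = a *\<^sub>R (\<Sum>k. x k * z k)"
  by (simp add: suminf_scaleR_right[OF summable_mult_bounded[OF assms]])

text \<open>Cauchy-Schwarz with weights \<open>norm (x k)\<close>, first for finite sections and
  then in the limit. The bound depends on \<open>x\<close> but not on \<open>l\<close>; it makes the
  best constant in \<open>square_function_le\<close> finite.\<close>

lemma sum_norm_suminf_le:
  fixes x :: "nat \<Rightarrow> 'k::{real_normed_field,banach}" and z :: "nat \<Rightarrow> nat \<Rightarrow> 'k"
  assumes x: "summable (\<lambda>k. norm (x k))" and z: "\<And>k. (\<Sum>i<l. norm (z i k)^2) \<le> 1"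
  shows "(\<Sum>i<l. norm (\<Sum>k. x k * z i k)^2) \<le> (\<Sum>k. norm (x k))^2"
proof -
  define M where "M = (\<Sum>k. norm (x k))"
  have zle: "norm (z i k) \<le> 1" if "i < l" for i k
  proof -
    have "norm (z i k)^2 \<le> (\<Sum>i<l. norm (z i k)^2)" by (rule member_le_sum) (use that in auto)
    with z[of k] show ?thesis by - (rule power2_le_imp_le, simp_all)
  qed
  have partial: "(\<Sum>k<n. norm (x k)) \<le> M" for n
    unfolding M_def by (intro sum_le_suminf x) auto
  have fin: "(\<Sum>i<l. norm (\<Sum>k<n. x k * z i k)^2) \<le> M^2" for n
  proof -
    have "norm (\<Sum>k<n. x k * z i k)^2 \<le> M * (\<Sum>k<n. norm (x k) * norm (z i k)^2)" for i
    proof -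
      \<comment> \<open>Each weight is split into two square roots, so that one Cauchy-Schwarz
        factor is the \<open>\<ell>\<^sub>1\<close>-norm and the other keeps
        \<open>norm (z i k)^2\<close>.\<close>
      have "norm (\<Sum>k<n. x k * z i k) \<le> (\<Sum>k<n. sqrt (norm (x k)) * (sqrt (norm (x k)) * norm (z i k)))"
        by (rule order.trans[OF norm_sum]) (simp add: norm_mult flip: mult.assoc)
      then have "norm (\<Sum>k<n. x k * z i k)^2
          \<le> (\<Sum>k<n. sqrt (norm (x k)) * (sqrt (norm (x k)) * norm (z i k)))^2"
        by (intro power_mono) auto
      also have "\<dots> \<le> (\<Sum>k<n. sqrt (norm (x k))^2) * (\<Sum>k<n. (sqrt (norm (x k)) * norm (z i k))^2)"
        by (rule Cauchy_Schwarz_ineq_sum)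
      also have "\<dots> \<le> M * (\<Sum>k<n. norm (x k) * norm (z i k)^2)"
        using partial[of n] by (auto simp: power_mult_distrib intro!: mult_right_mono sum_nonneg)
      finally show ?thesis .
    qed
    then have "(\<Sum>i<l. norm (\<Sum>k<n. x k * z i k)^2) \<le> (\<Sum>i<l. M * (\<Sum>k<n. norm (x k) * norm (z i k)^2))"
      by (intro sum_mono)
    also have "\<dots> = M * (\<Sum>k<n. norm (x k) * (\<Sum>i<l. norm (z i k)^2))"
      unfolding sum_distrib_left by (subst sum.swap) simp
    also have "\<dots> \<le> M * (\<Sum>k<n. norm (x k) * 1)"
      using z partial[of 0] by (intro mult_left_mono sum_mono) auto
    also have "\<dots> \<le> M * M" using partial[of n] partial[of 0] by (intro mult_left_mono) auto
    finally show ?thesis by (simp add: power2_eq_square)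
  qed
  have "(\<lambda>n. \<Sum>i<l. norm (\<Sum>k<n. x k * z i k)^2) \<longlonglongrightarrow> (\<Sum>i<l. norm (\<Sum>k. x k * z i k)^2)"
    using zle by (intro tendsto_sum tendsto_power tendsto_norm summable_LIMSEQ summable_mult_bounded[OF x]) auto
  then show ?thesis
    unfolding M_def[symmetric] by (rule LIMSEQ_le_const2) (use fin in auto)
qed

lemma sum_powr_norm_scale_le:
  fixes x :: "nat \<Rightarrow> nat \<Rightarrow> 'k::{real_normed_field,banach}"
  assumes hyp: "\<And>z. (\<And>k. norm (z k) \<le> 1) \<Longrightarrow> (\<Sum>j<m. norm (\<Sum>k. x j k * z k) powr r) \<le> W"
    and x: "\<And>j. j < m \<Longrightarrow> summable (\<lambda>k. norm (x j k))"
    and c: "c > 0" and z: "\<And>k. norm (z k) \<le> c"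
  shows "(\<Sum>j<m. norm (\<Sum>k. x j k * z k) powr r) \<le> c powr r * W"
proof -
  have "(\<Sum>k. x j k * z k) = c *\<^sub>R (\<Sum>k. x j k * (z k /\<^sub>R c))" if "j < m" for j
    using c by (subst suminf_mult_scaleR[OF x[OF that] z]) simp
  then have "(\<Sum>j<m. norm (\<Sum>k. x j k * z k) powr r)
      = c powr r * (\<Sum>j<m. norm (\<Sum>k. x j k * (z k /\<^sub>R c)) powr r)"
    using c by (simp add: sum_distrib_left powr_mult)
  also have "\<dots> \<le> c powr r * W"
    by (intro mult_left_mono hyp) (use c z in \<open>auto simp: field_simps\<close>)
  finally show ?thesis .
qed

text \<open>The best constant \<open>K\<close> is shown to satisfy
  \<open>K \<le> 262144 * W + K / 2\<close>. The truncated Rademacher sums contribute the first term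
  by \<open>hyp\<close>; the remainders form again an admissible family, and contribute the second
  by the definition of \<open>K\<close>.\<close>

lemma square_function_le:
  fixes x z :: "nat \<Rightarrow> nat \<Rightarrow> 'k::{real_normed_field,banach,real_inner}"
  assumes r: "1 \<le> r" "r \<le> 2"
    and x: "\<And>j. j < m \<Longrightarrow> summable (\<lambda>k. norm (x j k))"
    and hyp: "\<And>z. (\<And>k. norm (z k) \<le> 1) \<Longrightarrow> (\<Sum>j<m. norm (\<Sum>k. x j k * z k) powr r) \<le> W"
    and z: "\<And>k. (\<Sum>i<l. norm (z i k)^2) \<le> 1"
  shows "(\<Sum>j<m. (\<Sum>i<l. norm (\<Sum>k. x j k * z i k)^2) powr (r / 2)) \<le> 524288 * W"
proof -
  define f where "f j u = (\<Sum>k. x j k * u k)" for j u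
  define Q where "Q l z = (\<Sum>j<m. (\<Sum>i<l. norm (f j (z i))^2) powr (r / 2))" for l and z :: "nat \<Rightarrow> nat \<Rightarrow> 'k"
  \<comment> \<open>The length \<open>l\<close> varies within \<open>S\<close>, because the
    remainders give a family indexed by the \<open>N\<close> sample points instead of the original
    indices.\<close>
  define S where "S = {Q l z | l z. \<forall>k. (\<Sum>i<l. norm (z i k)^2) \<le> 1}"
  define K where "K = Sup S"
  have W: "W \<ge> 0" using hyp[of "\<lambda>k. 0"] r by simp
  have bdd: "bdd_above S"
  proof (rule bdd_aboveI)
    fix s assume "s \<in> S"
    then show "s \<le> (\<Sum>j<m. ((\<Sum>k. norm (x j k))^2) powr (r / 2))"
      using r x unfolding S_def Q_def f_def
      by (auto intro!: sum_mono powr_mono2 sum_norm_suminf_le sum_nonneg)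
  qed
  have le_K: "Q l z \<le> K" if "\<And>k. (\<Sum>i<l. norm (z i k)^2) \<le> 1" for l z
    unfolding K_def by (rule cSup_upper[OF _ bdd]) (use that in \<open>auto simp: S_def\<close>)
  have step: "Q l z \<le> 262144 * W + K / 2" if z: "\<And>k. (\<Sum>i<l. norm (z i k)^2) \<le> 1" for l z
  proof -
    obtain N :: nat and e :: "nat \<Rightarrow> nat \<Rightarrow> real" where N: "N > 0"
      and e2: "\<And>a :: nat \<Rightarrow> 'k.
        (\<Sum>\<omega><N. norm (\<Sum>i<l. e \<omega> i *\<^sub>R a i)^2) = real N * (\<Sum>i<l. norm (a i)^2)"
      and e4: "\<And>a :: nat \<Rightarrow> 'k.
        (\<Sum>\<omega><N. norm (\<Sum>i<l. e \<omega> i *\<^sub>R a i)^4) \<le> 3 * real N * (\<Sum>i<l. norm (a i)^2)^2"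
      using rademacher_moments[where 'a = 'k, of l] by blast
    define X where "X \<omega> k = (\<Sum>i<l. e \<omega> i *\<^sub>R z i k)" for \<omega> k
    \<comment> \<open>The level 128 is matched with the factor 64 in \<open>V\<close>. On the
      remainder \<open>norm (R \<omega> k)^2 \<le> norm (X \<omega> k)^4 / 128^2\<close>, so the
      squares of \<open>V\<close> sum to at most \<open>64^2 * 3 / 128^2 = 3 / 4\<close>. The losses
      16 and 2 in the moment comparisons then leave \<open>K\<close> with the coefficient
      \<open>16 * 2 / 64 = 1 / 2\<close>.\<close>
    define T where "T \<omega> k = (if norm (X \<omega> k) \<le> 128 then X \<omega> k else 0)" for \<omega> k
    define R where "R \<omega> k = (if norm (X \<omega> k) \<le> 128 then 0 else X \<omega> k)" for \<omega> k
    define V where "V \<omega> k = (64 / sqrt (real N)) *\<^sub>R R \<omega> k" for \<omega> k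
    define s where "s j = (\<Sum>i<l. norm (f j (z i))^2)" for j
    define \<rho> where "\<rho> j = (\<Sum>\<omega><N. norm (f j (R \<omega>))^2) / real N" for j
    have zle: "norm (z i k) \<le> 1" if "i < l" for i k
    proof -
      have "norm (z i k)^2 \<le> (\<Sum>i<l. norm (z i k)^2)" by (rule member_le_sum) (use that in auto)
      with z[of k] show ?thesis by - (rule power2_le_imp_le, simp_all)
    qed
    have Xle: "norm (X \<omega> k) \<le> (\<Sum>i<l. \<bar>e \<omega> i\<bar>)" for \<omega> k
      unfolding X_def by (rule order.trans[OF norm_sum]) (use zle in \<open>auto intro!: sum_mono mult_left_le\<close>)
    \<comment> \<open>A bound uniform in \<open>k\<close> is all that the convergence of the series
      \<open>f j (R \<omega>)\<close> requires; its size does not enter the final constant.\<close>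
    have Rle: "norm (R \<omega> k) \<le> (\<Sum>i<l. \<bar>e \<omega> i\<bar>)" for \<omega> k
      using Xle[of \<omega> k] by (auto simp: R_def intro: sum_nonneg)
    have fX: "f j (X \<omega>) = (\<Sum>i<l. e \<omega> i *\<^sub>R f j (z i))" if "j < m" for j \<omega>
    proof -
      have "f j (X \<omega>) = (\<Sum>k. \<Sum>i<l. e \<omega> i *\<^sub>R (x j k * z i k))"
        by (simp add: f_def X_def sum_distrib_left)
      also have "\<dots> = (\<Sum>i<l. \<Sum>k. e \<omega> i *\<^sub>R (x j k * z i k))"
        by (intro suminf_sum summable_scaleR_right summable_mult_bounded[OF x[OF that]]) (use zle in auto)
      also have "\<dots> = (\<Sum>i<l. e \<omega> i *\<^sub>R f j (z i))"
        unfolding f_def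
        by (intro sum.cong refl suminf_scaleR_right[symmetric] summable_mult_bounded[OF x[OF that]])
          (use zle in auto)
      finally show ?thesis .
    qed
    have fTR: "f j (X \<omega>) = f j (T \<omega>) + f j (R \<omega>)" if "j < m" for j \<omega>
    proof -
      have "summable (\<lambda>k. x j k * T \<omega> k)"
        by (rule summable_mult_bounded[OF x[OF that], where c = 128]) (auto simp: T_def)
      moreover have "summable (\<lambda>k. x j k * R \<omega> k)"
        by (rule summable_mult_bounded[OF x[OF that] Rle])
      ultimately have "f j (T \<omega>) + f j (R \<omega>) = (\<Sum>k. x j k * T \<omega> k + x j k * R \<omega> k)"
        unfolding f_def by (rule suminf_add)
      also have "\<dots> = f j (X \<omega>)" unfolding f_def by (intro suminf_cong) (simp add: T_def R_def)
      finally show ?thesis by simp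
    qed
    have khinchine: "real N * s j powr (r / 2)
        \<le> 16 * (\<Sum>\<omega><N. norm (f j (T \<omega>)) powr r) + 16 * (\<Sum>\<omega><N. norm (f j (R \<omega>)) powr r)"
      if j: "j < m" for j
    proof -
      have "real N * s j powr (r / 2) \<le> 4 * (\<Sum>\<omega><N. norm (f j (X \<omega>)) powr r)"
        using e2[of "\<lambda>i. f j (z i)"] e4[of "\<lambda>i. f j (z i)"]
        by (intro powr_half_mean_le[OF r]) (simp_all add: fX[OF j] s_def sum_nonneg)
      also have "\<dots> \<le> 4 * (\<Sum>\<omega><N. 4 * (norm (f j (T \<omega>)) powr r + norm (f j (R \<omega>)) powr r))"
        unfolding fTR[OF j] by (intro mult_left_mono sum_mono norm_add_powr_le[OF r]) auto
      finally show ?thesis by (simp add: sum.distrib sum_distrib_left[symmetric] algebra_simps)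
    qed
    have T: "(\<Sum>j<m. \<Sum>\<omega><N. norm (f j (T \<omega>)) powr r) \<le> real N * (16384 * W)"
    proof -
      \<comment> \<open>For each fixed \<open>\<omega>\<close> the sequence
        \<open>T \<omega>\<close> is a scalar sequence bounded by 128, so \<open>hyp\<close> applies
        after rescaling.\<close>
      have "(\<Sum>j<m. norm (f j (T \<omega>)) powr r) \<le> 128 powr r * W" for \<omega>
        unfolding f_def by (intro sum_powr_norm_scale_le hyp x) (auto simp: T_def)
      also have "128 powr r * W \<le> 128 powr 2 * W"
        using W r by (intro mult_right_mono powr_mono) auto
      finally have "(\<Sum>\<omega><N. \<Sum>j<m. norm (f j (T \<omega>)) powr r) \<le> (\<Sum>\<omega><N. 16384 * W)"
        by (intro sum_mono) simp
      then show ?thesis by (subst sum.swap) simp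
    qed
    have "(\<Sum>\<omega><N. norm (V \<omega> k)^2) \<le> 1" for k
    proof -
      have "norm (R \<omega> k)^2 \<le> norm (X \<omega> k)^4 / 16384" for \<omega>
      proof (cases "norm (X \<omega> k) \<le> 128")
        case False
        then have "128^2 * norm (X \<omega> k)^2 \<le> norm (X \<omega> k)^2 * norm (X \<omega> k)^2"
          by (intro mult_right_mono power_mono) auto
        then show ?thesis using False by (simp add: R_def flip: power_add)
      qed (simp add: R_def)
      then have "norm (V \<omega> k)^2 \<le> 4096 / real N * (norm (X \<omega> k)^4 / 16384)" for \<omega>
      proof -
        have "norm (V \<omega> k)^2 = 4096 / real N * norm (R \<omega> k)^2"
          by (simp add: V_def power_mult_distrib power_divide)
        also have "\<dots> \<le> 4096 / real N * (norm (X \<omega> k)^4 / 16384)"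
          by (intro mult_left_mono \<open>norm (R \<omega> k)^2 \<le> norm (X \<omega> k)^4 / 16384\<close>) simp
        finally show ?thesis .
      qed
      then have "(\<Sum>\<omega><N. norm (V \<omega> k)^2) \<le> (\<Sum>\<omega><N. norm (X \<omega> k)^4) / (4 * real N)"
        by (subst sum_divide_distrib) (intro sum_mono, simp add: field_simps)
      also have "\<dots> \<le> (3 * real N * (\<Sum>i<l. norm (z i k)^2)^2) / (4 * real N)"
        using e4[of "\<lambda>i. z i k"] by (intro divide_right_mono) (auto simp: X_def)
      also have "\<dots> \<le> (3 * real N * 1) / (4 * real N)"
        using z[of k] by (intro divide_right_mono mult_left_mono power_le_one sum_nonneg) auto
      finally show ?thesis using N by simp
    qed
    then have "Q N V \<le> K" by (rule le_K)
    have fV: "f j (V \<omega>) = (64 / sqrt (real N)) *\<^sub>R f j (R \<omega>)" if "j < m" for j \<omega>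
      unfolding f_def V_def by (rule suminf_mult_scaleR[OF x[OF that] Rle])
    \<comment> \<open>The factor \<open>1 / sqrt (real N)\<close> in \<open>V\<close> turns the mean
      over the sample space into a plain sum of squares, and \<open>r \<ge> 1\<close> keeps at least
      a factor 64.\<close>
    have \<rho>: "64 * \<rho> j powr (r / 2) \<le> (\<Sum>\<omega><N. norm (f j (V \<omega>))^2) powr (r / 2)" if "j < m" for j
    proof -
      have \<rho>0: "\<rho> j \<ge> 0" by (simp add: \<rho>_def sum_nonneg)
      have "(\<Sum>\<omega><N. norm (f j (V \<omega>))^2) = 64^2 * \<rho> j"
        by (simp add: fV[OF that] power_mult_distrib power_divide \<rho>_def sum_divide_distrib sum_distrib_left)
      then have "(\<Sum>\<omega><N. norm (f j (V \<omega>))^2) powr (r / 2) = 64 powr r * \<rho> j powr (r / 2)"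
        using \<rho>0 power2_powr_half[of 64 r] by (simp add: powr_mult)
      moreover have "64 powr 1 \<le> (64::real) powr r" using r by (intro powr_mono) auto
      ultimately show ?thesis by (auto intro: mult_right_mono)
    qed
    have "real N * Q l z = (\<Sum>j<m. real N * s j powr (r / 2))"
      by (simp add: Q_def s_def sum_distrib_left)
    also have "\<dots> \<le> (\<Sum>j<m. 16 * (\<Sum>\<omega><N. norm (f j (T \<omega>)) powr r)
        + 16 * (2 * real N * \<rho> j powr (r / 2)))"
    proof (intro sum_mono)
      fix j assume "j \<in> {..<m}"
      then have "real N * s j powr (r / 2)
          \<le> 16 * (\<Sum>\<omega><N. norm (f j (T \<omega>)) powr r) + 16 * (\<Sum>\<omega><N. norm (f j (R \<omega>)) powr r)"
        by (intro khinchine) simp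
      also have "(\<Sum>\<omega><N. norm (f j (R \<omega>)) powr r) \<le> 2 * real N * \<rho> j powr (r / 2)"
        unfolding \<rho>_def by (intro sum_powr_le_mean_powr[OF r _ N]) simp
      finally show "real N * s j powr (r / 2) \<le> 16 * (\<Sum>\<omega><N. norm (f j (T \<omega>)) powr r)
        + 16 * (2 * real N * \<rho> j powr (r / 2))" by simp
    qed
    also have "\<dots> = 16 * (\<Sum>j<m. \<Sum>\<omega><N. norm (f j (T \<omega>)) powr r)
        + real N / 2 * (\<Sum>j<m. 64 * \<rho> j powr (r / 2))"
      by (simp add: sum.distrib sum_distrib_left)
    also have "\<dots> \<le> 16 * (real N * (16384 * W)) + real N / 2 * K"
    proof (intro add_mono mult_left_mono T)
      have "(\<Sum>j<m. 64 * \<rho> j powr (r / 2)) \<le> Q N V"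
        unfolding Q_def by (intro sum_mono \<rho>) simp
      then show "(\<Sum>j<m. 64 * \<rho> j powr (r / 2)) \<le> K" using \<open>Q N V \<le> K\<close> by simp
    qed auto
    also have "\<dots> = real N * (262144 * W + K / 2)" by (simp add: algebra_simps)
    finally show ?thesis using N by simp
  qed
  \<comment> \<open>Since \<open>K\<close> is a real number by \<open>bdd\<close>, the term
    \<open>K / 2\<close> can be absorbed, which doubles the constant 262144.\<close>
  have "S \<noteq> {}" unfolding S_def by (auto intro: exI[of _ 0])
  then have "K \<le> 262144 * W + K / 2"
    unfolding K_def by (rule cSup_least) (use step in \<open>auto simp: S_def K_def\<close>)
  moreover have "Q l z \<le> K" by (rule le_K[OF z])
  ultimately have "Q l z \<le> 524288 * W" by linarith
  then show ?thesis by (simp add: Q_def f_def)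
qed

text \<open>Divided by \<open>B powr (1 / r)\<close>, the \<open>z j\<close> become an admissible
  family for \<open>square_function_le\<close>, with one member for each \<open>x j\<close>. In the
  square function of \<open>x j\<close> only the member with the same index is then kept.\<close>

lemma diagonal_sum_le:
  fixes x z :: "nat \<Rightarrow> nat \<Rightarrow> 'k::{real_normed_field,banach,real_inner}"
  assumes r: "1 \<le> r" "r \<le> 2"
    and x: "\<And>j. j < m \<Longrightarrow> summable (\<lambda>k. norm (x j k))"
    and hyp: "\<And>z. (\<And>k. norm (z k) \<le> 1) \<Longrightarrow> (\<Sum>j<m. norm (\<Sum>k. x j k * z k) powr r) \<le> W"
    and z: "\<And>k. (\<Sum>j<m. norm (z j k) powr r) \<le> B"
  shows "(\<Sum>j<m. norm (\<Sum>k. x j k * z j k) powr r) \<le> 524288 * W * B"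
proof -
  have B: "B \<ge> 0" using z[of 0] by (meson order.trans powr_ge_zero sum_nonneg)
  have zB: "norm (z j k) powr r \<le> B" if "j < m" for j k
    by (rule order.trans[OF member_le_sum[of j "{..<m}"] z[of k]]) (use that in auto)
  show ?thesis
  proof (cases "B = 0")
    case True
    then have "z j k = 0" if "j < m" for j k
      using zB[OF that, of k] by simp
    then show ?thesis using True by simp
  next
    case False
    with B have "B > 0" by simp
    define c where "c = B powr (1 / r)"
    have c: "c > 0" and cr: "c powr r = B" using \<open>B > 0\<close> r by (auto simp: c_def powr_powr)
    define y where "y i k = (if i < m then z i k /\<^sub>R c else 0)" for i k
    have zc: "norm (z j k) \<le> c" if "j < m" for j k
    proof -
      have "(norm (z j k) powr r) powr (1 / r) \<le> c"
        unfolding c_def using zB[OF that, of k] r by (intro powr_mono2) auto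
      then show ?thesis using r by (simp add: powr_powr)
    qed
    have "(\<Sum>i<m. norm (y i k)^2) \<le> 1" for k
    proof -
      have "norm (y i k)^2 \<le> norm (z i k) powr r / B" if "i < m" for i
      proof -
        define t where "t = norm (z i k) / c"
        have t: "0 \<le> t" "t \<le> 1" using zc[OF that, of k] c by (auto simp: t_def)
        have "t powr 2 \<le> t powr r" using t r by (intro powr_mono') auto
        then have "t^2 \<le> t powr r" using t by (cases "t = 0") auto
        also have "\<dots> = norm (z i k) powr r / B" using c by (simp add: t_def powr_divide cr)
        finally show ?thesis using that c by (simp add: y_def t_def divide_inverse mult.commute)
      qed
      then have "(\<Sum>i<m. norm (y i k)^2) \<le> (\<Sum>i<m. norm (z i k) powr r / B)" by (intro sum_mono) auto
      also have "\<dots> \<le> 1" using z[of k] \<open>B > 0\<close> by (simp flip: sum_divide_distrib)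
      finally show ?thesis .
    qed
    from square_function_le[OF r x hyp this]
    have main: "(\<Sum>j<m. (\<Sum>i<m. norm (\<Sum>k. x j k * y i k)^2) powr (r / 2)) \<le> 524288 * W" by simp
    have "norm (\<Sum>k. x j k * z j k) powr r \<le> B * (\<Sum>i<m. norm (\<Sum>k. x j k * y i k)^2) powr (r / 2)"
      if "j < m" for j
    proof -
      have "(\<Sum>k. x j k * z j k) = c *\<^sub>R (\<Sum>k. x j k * y j k)"
        unfolding y_def using that c by (simp only: if_True suminf_mult_scaleR[OF x[OF that] zc[OF that]]) simp
      then have "norm (\<Sum>k. x j k * z j k) powr r = B * norm (\<Sum>k. x j k * y j k) powr r"
        using c by (simp add: powr_mult cr)
      also have "\<dots> = B * (norm (\<Sum>k. x j k * y j k)^2) powr (r / 2)"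
        by (simp add: power2_powr_half)
      also have "\<dots> \<le> B * (\<Sum>i<m. norm (\<Sum>k. x j k * y i k)^2) powr (r / 2)"
        using that B r
        by (intro mult_left_mono powr_mono2 member_le_sum[where f = "\<lambda>i. norm (\<Sum>k. x j k * y i k)^2"]) auto
      finally show ?thesis .
    qed
    then have "(\<Sum>j<m. norm (\<Sum>k. x j k * z j k) powr r)
        \<le> B * (\<Sum>j<m. (\<Sum>i<m. norm (\<Sum>k. x j k * y i k)^2) powr (r / 2))"
      unfolding sum_distrib_left by (intro sum_mono) auto
    also have "\<dots> \<le> B * (524288 * W)" by (intro mult_left_mono main B)
    finally show ?thesis by (simp add: mult_ac)
  qed
qed

section \<open>Sequence spaces and their duals\<close>

text \<open>Convexity of the power function on the closed half-line. When \<open>u\<close> or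
  \<open>v\<close> vanishes, the claim reduces to \<open>s powr q \<le> s\<close> for a weight
  \<open>s\<close> in the unit interval.\<close>

lemma powr_convex_comb_le:
  fixes u v t :: real
  assumes q: "q \<ge> 1" and uv: "u \<ge> 0" "v \<ge> 0" and t: "0 \<le> t" "t \<le> 1"
  shows "((1 - t) * u + t * v) powr q \<le> (1 - t) * u powr q + t * v powr q"
proof -
  have le: "s powr q \<le> s" if "0 \<le> s" "s \<le> 1" for s :: real
  proof -
    have "s powr q \<le> s powr 1" by (rule powr_mono') (use that q in auto)
    then show ?thesis using that(1) by simp
  qed
  consider "u = 0" | "v = 0" | "u > 0" "v > 0" using uv by linarith
  then show ?thesis
  proof cases
    case 1
    then show ?thesis using le[of t] t uv q by (auto simp: powr_mult intro: mult_right_mono)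
  next
    case 2
    then show ?thesis using le[of "1 - t"] t uv q by (auto simp: powr_mult intro: mult_right_mono)
  next
    case 3
    then show ?thesis using convex_onD[OF powr_convex[OF q], of t u v] t by auto
  qed
qed

lemma lp_car: "x \<in> car (lp_space q) \<longleftrightarrow> summable (\<lambda>k. norm (x k) powr q)"
  by (simp add: lp_space_def)

lemma lp_vadd: "vadd (lp_space q) x y = (\<lambda>k. x k + y k)"
  by (simp add: lp_space_def)

lemma lp_vscale: "vscale (lp_space q) c x = (\<lambda>k. c * x k)"
  by (simp add: lp_space_def)

lemma lp_vnorm: "vnorm (lp_space q) x = (\<Sum>k. norm (x k) powr q) powr (1 / q)"
  by (simp add: lp_space_def)

lemmas lp_simps = lp_vadd lp_vscale

lemma lp_vnorm_nonneg: "vnorm (lp_space q) x \<ge> 0"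
  by (simp add: lp_vnorm)

lemma l1_car: "x \<in> car (lp_space 1) \<longleftrightarrow> summable (\<lambda>k. norm (x k))"
  by (simp add: lp_car)

lemma l1_vnorm: "x \<in> car (lp_space 1) \<Longrightarrow> vnorm (lp_space 1) x = (\<Sum>k. norm (x k))"
  by (simp add: lp_vnorm lp_car suminf_nonneg)

lemma lp_finite_support_in_car:
  assumes "finite S" "\<And>k. k \<notin> S \<Longrightarrow> x k = 0"
  shows "x \<in> car (lp_space q)"
  unfolding lp_car by (rule summable_finite[OF assms(1)]) (simp add: assms(2))

lemma lp_scale_in_car: "x \<in> car (lp_space q) \<Longrightarrow> (\<lambda>k. c * x k) \<in> car (lp_space q)"
  by (simp add: lp_car norm_mult powr_mult summable_mult)

lemma lp_vnorm_scale:
  assumes "q \<ge> 1" "x \<in> car (lp_space q)"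
  shows "vnorm (lp_space q) (\<lambda>k. c * x k) = norm c * vnorm (lp_space q) x"
  using assms
  by (simp add: lp_vnorm lp_car norm_mult powr_mult suminf_mult suminf_nonneg powr_powr)

lemma lp_vnorm_powr:
  assumes "q \<ge> 1" "x \<in> car (lp_space q)"
  shows "vnorm (lp_space q) x powr q = (\<Sum>k. norm (x k) powr q)"
  using assms by (simp add: lp_vnorm powr_powr suminf_nonneg lp_car)

lemma lp_vnorm_zero: "vnorm (lp_space q) (\<lambda>k. 0) = 0"
  by (simp add: lp_vnorm)

lemma lp_vnorm_eq_0_iff:
  assumes "q \<ge> 1" "x \<in> car (lp_space q)"
  shows "vnorm (lp_space q) x = 0 \<longleftrightarrow> x = (\<lambda>k. 0)"
proof
  assume "vnorm (lp_space q) x = 0"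
  then have "(\<Sum>k. norm (x k) powr q) = 0" by (simp add: lp_vnorm)
  then show "x = (\<lambda>k. 0)" using assms(2) by (auto simp: lp_car suminf_eq_zero_iff)
qed (simp add: lp_vnorm_zero)

text \<open>Minkowski's inequality by convexity: \<open>x + y\<close> is \<open>a + b\<close> times
  a convex combination of the normalised sequences \<open>x / a\<close> and \<open>y / b\<close>.
  The same dominating series gives membership and the triangle inequality.\<close>

lemma lp_add:
  assumes q: "q \<ge> 1" and x: "x \<in> car (lp_space q)" and y: "y \<in> car (lp_space q)"
  shows "(\<lambda>k. x k + y k) \<in> car (lp_space q)"
    and "vnorm (lp_space q) (\<lambda>k. x k + y k) \<le> vnorm (lp_space q) x + vnorm (lp_space q) y"
proof -
  define a where "a = vnorm (lp_space q) x"
  define b where "b = vnorm (lp_space q) y"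
  have ab: "a \<ge> 0" "b \<ge> 0" by (simp_all add: a_def b_def lp_vnorm_nonneg)
  have "(\<lambda>k. x k + y k) \<in> car (lp_space q) \<and> vnorm (lp_space q) (\<lambda>k. x k + y k) \<le> a + b"
  proof (cases "a = 0 \<or> b = 0")
    case True
    then have "x = (\<lambda>k. 0) \<or> y = (\<lambda>k. 0)" using q x y by (auto simp: a_def b_def lp_vnorm_eq_0_iff)
    then show ?thesis using x y by (auto simp: a_def b_def lp_vnorm_zero)
  next
    case False
    with ab have a: "a > 0" and b: "b > 0" by auto
    define t where "t = b / (a + b)"
    have t: "0 \<le> t" "t \<le> 1" and t1: "1 - t = a / (a + b)" using a b by (auto simp: t_def field_simps)
    \<comment> \<open>The weights are chosen so that this majorant sums to exactly
      \<open>(a + b) powr q\<close>.\<close>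
    define g where "g k = (a + b) powr q * ((1 - t) * (norm (x k) powr q / a powr q)
        + t * (norm (y k) powr q / b powr q))" for k
    have xs: "(\<lambda>k. norm (x k) powr q) sums (a powr q)"
      using x lp_vnorm_powr[OF q x] by (simp add: a_def lp_car sums_iff)
    have ys: "(\<lambda>k. norm (y k) powr q) sums (b powr q)"
      using y lp_vnorm_powr[OF q y] by (simp add: b_def lp_car sums_iff)
    have "g sums ((a + b) powr q * ((1 - t) * (a powr q / a powr q) + t * (b powr q / b powr q)))"
      unfolding g_def by (intro sums_mult sums_add sums_divide xs ys)
    then have g: "g sums ((a + b) powr q)" using a b by simp
    have le: "norm (x k + y k) powr q \<le> g k" for k
    proof -
      have "norm (x k + y k) powr q \<le> (norm (x k) + norm (y k)) powr q"
        using q by (intro powr_mono2 norm_triangle_ineq) auto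
      also have "norm (x k) + norm (y k) = (a + b) * ((1 - t) * (norm (x k) / a) + t * (norm (y k) / b))"
      proof -
        have "(a + b) * (1 - t) = a" "(a + b) * t = b" using a b by (simp_all add: t1) (simp add: t_def)
        then show ?thesis using a b by (simp add: distrib_left mult.assoc[symmetric])
      qed
      also have "\<dots> powr q = (a + b) powr q * ((1 - t) * (norm (x k) / a) + t * (norm (y k) / b)) powr q"
        by (rule powr_mult)
      also have "\<dots> \<le> (a + b) powr q * ((1 - t) * (norm (x k) / a) powr q + t * (norm (y k) / b) powr q)"
        using a b t q by (intro mult_left_mono powr_convex_comb_le) auto
      finally show ?thesis using a b by (simp add: g_def powr_divide)
    qed
    have summ: "summable (\<lambda>k. norm (x k + y k) powr q)"
      by (rule summable_comparison_test'[OF sums_summable[OF g], of 0]) (simp add: le)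
    then have "(\<Sum>k. norm (x k + y k) powr q) \<le> (a + b) powr q"
      using suminf_le[OF le summ sums_summable[OF g]] g by (simp add: sums_iff)
    then have "vnorm (lp_space q) (\<lambda>k. x k + y k) \<le> ((a + b) powr q) powr (1 / q)"
      unfolding lp_vnorm using q summ by (intro powr_mono2 suminf_nonneg) auto
    then show ?thesis using summ a b q by (simp add: lp_car powr_powr)
  qed
  then show "(\<lambda>k. x k + y k) \<in> car (lp_space q)"
    and "vnorm (lp_space q) (\<lambda>k. x k + y k) \<le> vnorm (lp_space q) x + vnorm (lp_space q) y"
    by (simp_all add: a_def b_def)
qed

lemma lp_diff_in_car:
  assumes "q \<ge> 1" "x \<in> car (lp_space q)" "y \<in> car (lp_space q)"
  shows "(\<lambda>k. x k - y k) \<in> car (lp_space q)"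
  using lp_add(1)[OF assms(1,2) lp_scale_in_car[OF assms(3), of "- 1"]] by simp

lemma lp_Metric_space:
  assumes q: "q \<ge> 1"
  shows "Metric_space (car (lp_space q)) (\<lambda>x y. vnorm (lp_space q) (\<lambda>k. x k - y k))"
proof
  fix x y z :: "nat \<Rightarrow> 'k::real_normed_field"
  show "0 \<le> vnorm (lp_space q) (\<lambda>k. x k - y k)" by (rule lp_vnorm_nonneg)
  show "vnorm (lp_space q) (\<lambda>k. x k - y k) = vnorm (lp_space q) (\<lambda>k. y k - x k)"
    unfolding lp_vnorm by (subst norm_minus_commute) (rule refl)
  assume xy: "x \<in> car (lp_space q)" "y \<in> car (lp_space q)"
  show "vnorm (lp_space q) (\<lambda>k. x k - y k) = 0 \<longleftrightarrow> x = y"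
    using lp_vnorm_eq_0_iff[OF q lp_diff_in_car[OF q xy]] by (auto simp: fun_eq_iff)
  assume z: "z \<in> car (lp_space q)"
  show "vnorm (lp_space q) (\<lambda>k. x k - z k)
      \<le> vnorm (lp_space q) (\<lambda>k. x k - y k) + vnorm (lp_space q) (\<lambda>k. y k - z k)"
    using lp_add(2)[OF q lp_diff_in_car[OF q xy] lp_diff_in_car[OF q xy(2) z]] by simp
qed

lemma norm_topology_lp:
  "norm_topology (lp_space q)
    = Metric_space.mtopology (car (lp_space q)) (\<lambda>x y. vnorm (lp_space q) (\<lambda>k. x k - y k))"
  by (simp add: norm_topology_def lp_simps)

lemma openin_lp:
  assumes "q \<ge> 1"
  shows "openin (norm_topology (lp_space q)) U \<longleftrightarrow> U \<subseteq> car (lp_space q) \<and>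
    (\<forall>x\<in>U. \<exists>d>0. \<forall>y\<in>car (lp_space q). vnorm (lp_space q) (\<lambda>k. x k - y k) < d \<longrightarrow> y \<in> U)"
proof -
  interpret Metric_space "car (lp_space q)" "\<lambda>x y. vnorm (lp_space q) (\<lambda>k. x k - y k)"
    by (rule lp_Metric_space[OF assms])
  have "mball x d \<subseteq> U \<longleftrightarrow> (\<forall>y\<in>car (lp_space q). vnorm (lp_space q) (\<lambda>k. x k - y k) < d \<longrightarrow> y \<in> U)"
    if "U \<subseteq> car (lp_space q)" "x \<in> U" for x d
    using that by (auto simp: mball_def)
  then show ?thesis unfolding norm_topology_lp openin_mtopology Ball_def[of U] by blast
qed

lemma topspace_lp: "q \<ge> 1 \<Longrightarrow> topspace (norm_topology (lp_space q)) = car (lp_space q)"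
  unfolding norm_topology_lp by (rule Metric_space.topspace_mtopology[OF lp_Metric_space])

lemma lp_bounded_imp_continuous:
  assumes q: "q \<ge> 1"
    and add: "\<And>x y. x \<in> car (lp_space q) \<Longrightarrow> y \<in> car (lp_space q) \<Longrightarrow> \<phi> (\<lambda>k. x k + y k) = \<phi> x + \<phi> y"
    and bound: "\<And>x. x \<in> car (lp_space q) \<Longrightarrow> norm (\<phi> x) \<le> M * vnorm (lp_space q) x"
  shows "continuous_map (norm_topology (lp_space q)) euclidean (\<phi> :: (nat \<Rightarrow> 'k::real_normed_field) \<Rightarrow> 'k)"
  unfolding continuous_map topspace_lp[OF q]
proof (intro conjI allI impI)
  fix U :: "'k set" assume "openin euclidean U"
  then have "open U" by simp
  show "openin (norm_topology (lp_space q)) {x \<in> car (lp_space q). \<phi> x \<in> U}"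
    unfolding openin_lp[OF q]
  proof (intro conjI ballI)
    fix x assume "x \<in> {x \<in> car (lp_space q). \<phi> x \<in> U}"
    then have x: "x \<in> car (lp_space q)" and "\<phi> x \<in> U" by auto
    then obtain e where e: "e > 0" "\<And>w. dist w (\<phi> x) < e \<Longrightarrow> w \<in> U"
      using \<open>open U\<close> by (metis open_dist)
    \<comment> \<open>\<open>M\<close> may be zero or negative, whereas the radius
      \<open>e / M'\<close> has to be positive.\<close>
    define M' where "M' = max M 1"
    show "\<exists>d>0. \<forall>y\<in>car (lp_space q). vnorm (lp_space q) (\<lambda>k. x k - y k) < d
        \<longrightarrow> y \<in> {x \<in> car (lp_space q). \<phi> x \<in> U}"
    proof (intro exI[of _ "e / M'"] conjI ballI impI)
      show "e / M' > 0" using e by (simp add: M'_def)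
      fix y assume y: "y \<in> car (lp_space q)" and d: "vnorm (lp_space q) (\<lambda>k. x k - y k) < e / M'"
      have "\<phi> x = \<phi> (\<lambda>k. x k - y k) + \<phi> y" using add[OF lp_diff_in_car[OF q x y] y] by simp
      then have "norm (\<phi> x - \<phi> y) \<le> M * vnorm (lp_space q) (\<lambda>k. x k - y k)"
        using bound[OF lp_diff_in_car[OF q x y]] by simp
      also have "\<dots> \<le> M' * vnorm (lp_space q) (\<lambda>k. x k - y k)"
        by (intro mult_right_mono) (auto simp: M'_def lp_vnorm_nonneg)
      also have "\<dots> < e" using d by (simp add: M'_def field_simps)
      finally show "y \<in> {x \<in> car (lp_space q). \<phi> x \<in> U}"
        using y e(2) by (simp add: dist_norm norm_minus_commute)
    qed
  qed auto
qed auto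

text \<open>Homogeneity extends the bound from the unit ball to the whole space; the vector of norm
  0 is treated apart, since it cannot be normalised.\<close>

lemma dual_ball_le:
  assumes q: "q \<ge> 1" and \<phi>: "\<phi> \<in> dual_ball (lp_space q)" and x: "x \<in> car (lp_space q)"
  shows "norm (\<phi> x) \<le> vnorm (lp_space q) (x :: nat \<Rightarrow> 'k::real_normed_field)"
proof -
  define c where "c = vnorm (lp_space q) x"
  have scale: "\<phi> (\<lambda>k. a * x k) = a * \<phi> x" for a
    using \<phi> x unfolding dual_ball_def dual_space_def lp_simps by blast
  have one: "norm (\<phi> y) \<le> 1" if "y \<in> car (lp_space q)" "vnorm (lp_space q) y \<le> 1" for y
    using \<phi> that by (auto simp: dual_ball_def)
  show ?thesis
  proof (cases "c = 0")
    case True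
    then have "x = (\<lambda>k. 0)" using lp_vnorm_eq_0_iff[OF q x] by (simp add: c_def)
    then show ?thesis using scale[of 0] by (simp add: lp_vnorm_zero)
  next
    case False
    then have c: "c > 0" using lp_vnorm_nonneg[of q x] by (simp add: c_def)
    have "norm (\<phi> (\<lambda>k. inverse (of_real c) * x k)) \<le> 1"
      using c by (intro one lp_scale_in_car x) (simp add: lp_vnorm_scale[OF q x] c_def[symmetric] norm_inverse)
    then have "inverse c * norm (\<phi> x) \<le> 1"
      using c unfolding scale norm_mult by (simp add: norm_inverse)
    then show ?thesis using c by (simp add: c_def[symmetric] field_simps)
  qed
qed

section \<open>Lower bounds for weak norms\<close>

lemma weak_norm_ge:
  assumes q: "q \<ge> 1" and r: "r \<ge> 1" and x: "\<And>j. j < m \<Longrightarrow> x j \<in> car (lp_space q)"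
    and \<phi>: "\<phi> \<in> dual_ball (lp_space q)"
  shows "(\<Sum>j<m. norm (\<phi> (x j)) powr r) powr (1 / r)
    \<le> weak_norm r (lp_space q) m (x :: nat \<Rightarrow> nat \<Rightarrow> 'k::real_normed_field)"
  unfolding weak_norm_def
proof (rule cSUP_upper[OF \<phi>])
  \<comment> \<open>A supremum of reals dominates its members only when the set is bounded; here the
    strong norm of the family is an upper bound.\<close>
  show "bdd_above ((\<lambda>\<phi>. (\<Sum>j<m. norm (\<phi> (x j)) powr r) powr (1 / r)) ` dual_ball (lp_space q))"
  proof (rule bdd_aboveI2)
    fix \<psi> assume "\<psi> \<in> dual_ball (lp_space q :: ('k, nat \<Rightarrow> 'k) nspace)"
    then show "(\<Sum>j<m. norm (\<psi> (x j)) powr r) powr (1 / r)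
        \<le> (\<Sum>j<m. vnorm (lp_space q) (x j) powr r) powr (1 / r)"
      using r x by (intro powr_mono2 sum_mono dual_ball_le[OF q] sum_nonneg) auto
  qed
qed

text \<open>Dividing by \<open>M\<close> and restricting to the carrier turns a bounded linear
  \<open>\<phi>\<close> into a member of the dual ball. The estimate is stated in
  \<open>r\<close>-th powers, the form in which it is iterated later.\<close>

lemma sum_functional_le_weak_norm:
  fixes \<phi> :: "(nat \<Rightarrow> 'k::real_normed_field) \<Rightarrow> 'k"
  assumes q: "q \<ge> 1" and r: "r \<ge> 1" and x: "\<And>j. j < m \<Longrightarrow> x j \<in> car (lp_space q)"
    and add: "\<And>x y. x \<in> car (lp_space q) \<Longrightarrow> y \<in> car (lp_space q) \<Longrightarrow> \<phi> (\<lambda>k. x k + y k) = \<phi> x + \<phi> y"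
    and scale: "\<And>c x. x \<in> car (lp_space q) \<Longrightarrow> \<phi> (\<lambda>k. c * x k) = c * \<phi> x"
    and bound: "\<And>x. x \<in> car (lp_space q) \<Longrightarrow> norm (\<phi> x) \<le> M * vnorm (lp_space q) x"
    and M: "M > 0"
  shows "(\<Sum>j<m. norm (\<phi> (x j)) powr r) \<le> M powr r * weak_norm r (lp_space q) m x powr r"
proof -
  define \<psi> where "\<psi> = restrict (\<lambda>x. \<phi> x / of_real M) (car (lp_space q))"
  have eq: "\<psi> u = \<phi> u / of_real M" if "u \<in> car (lp_space q)" for u
    using that by (simp add: \<psi>_def)
  have le: "norm (\<psi> u) \<le> 1 * vnorm (lp_space q) u" if "u \<in> car (lp_space q)" for u
    using bound[OF that] M by (simp add: eq[OF that] norm_divide field_simps)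
  have psi_add: "\<psi> (\<lambda>k. u k + v k) = \<psi> u + \<psi> v"
    if "u \<in> car (lp_space q)" "v \<in> car (lp_space q)" for u v
    using that by (simp add: eq lp_add(1)[OF q] add add_divide_distrib)
  have "\<psi> \<in> dual_space (lp_space q)"
    unfolding dual_space_def lp_simps
  proof (intro CollectI conjI ballI allI)
    show "continuous_map (norm_topology (lp_space q)) euclidean \<psi>"
      by (rule lp_bounded_imp_continuous[OF q psi_add le])
  qed (simp add: \<psi>_def, rule psi_add, simp_all add: eq scale lp_scale_in_car)
  then have "\<psi> \<in> dual_ball (lp_space q)"
    using order.trans[OF le] by (simp add: dual_ball_def)
  from weak_norm_ge[OF q r x this]
  have "((\<Sum>j<m. norm (\<psi> (x j)) powr r) powr (1 / r)) powr r \<le> weak_norm r (lp_space q) m x powr r"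
    using r by (intro powr_mono2) auto
  moreover have "(\<Sum>j<m. norm (\<psi> (x j)) powr r) = (\<Sum>j<m. norm (\<phi> (x j)) powr r) / M powr r"
    using x M by (simp add: eq norm_divide powr_divide sum_divide_distrib)
  moreover have "((\<Sum>j<m. norm (\<phi> (x j)) powr r) / M powr r) \<ge> 0"
    by (simp add: sum_nonneg)
  ultimately show ?thesis using r M by (simp add: powr_powr field_simps)
qed

section \<open>Multilinear forms on sequence spaces\<close>

definition unit_seq :: "nat \<Rightarrow> nat \<Rightarrow> 'k::zero_neq_one" where
  "unit_seq k i = (if i = k then 1 else 0)"

lemma unit_seq_in_car: "unit_seq k \<in> car (lp_space q)"
  by (rule lp_finite_support_in_car[of "{k}"]) (auto simp: unit_seq_def)

lemma vnorm_unit_seq: "vnorm (lp_space q) (unit_seq k :: nat \<Rightarrow> 'k::real_normed_field) = 1"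
proof -
  have "(\<Sum>i. norm (unit_seq k i :: 'k) powr q) = (\<Sum>i\<in>{k}. norm (unit_seq k i :: 'k) powr q)"
    by (rule suminf_finite) (auto simp: unit_seq_def)
  then show ?thesis by (simp add: lp_vnorm unit_seq_def)
qed

text \<open>The truncations of \<open>u\<close> converge to \<open>u\<close> in the
  \<open>\<ell>\<^sub>1\<close>-norm, because the error is the tail of
  \<open>\<Sum>k. norm (u k)\<close>. On truncations the formula is finite linearity.\<close>

lemma l1_functional_expansion:
  fixes \<psi> :: "(nat \<Rightarrow> 'k::real_normed_field) \<Rightarrow> 'k"
  assumes add: "\<And>x y. x \<in> car (lp_space 1) \<Longrightarrow> y \<in> car (lp_space 1) \<Longrightarrow> \<psi> (\<lambda>k. x k + y k) = \<psi> x + \<psi> y"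
    and scale: "\<And>c x. x \<in> car (lp_space 1) \<Longrightarrow> \<psi> (\<lambda>k. c * x k) = c * \<psi> x"
    and bound: "\<And>x. x \<in> car (lp_space 1) \<Longrightarrow> norm (\<psi> x) \<le> M * vnorm (lp_space 1) x"
    and u: "u \<in> car (lp_space 1)"
  shows "\<psi> u = (\<Sum>k. u k * \<psi> (unit_seq k))"
proof -
  define t where "t n = (\<lambda>k. if k < n then u k else 0)" for n
  have t: "t n \<in> car (lp_space 1)" for n
    by (rule lp_finite_support_in_car[of "{..<n}"]) (auto simp: t_def)
  have psi_t: "\<psi> (t n) = (\<Sum>k<n. u k * \<psi> (unit_seq k))" for n
  proof (induction n)
    case 0
    have "t 0 = (\<lambda>k. 0 * u k)" by (simp add: t_def)
    then show ?case using scale[OF u, of 0] by simp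
  next
    case (Suc n)
    have "t (Suc n) = (\<lambda>k. t n k + u n * unit_seq n k)" by (auto simp: t_def unit_seq_def fun_eq_iff less_Suc_eq)
    then have "\<psi> (t (Suc n)) = \<psi> (t n) + u n * \<psi> (unit_seq n)"
      by (simp add: add[OF t lp_scale_in_car[OF unit_seq_in_car]] scale[OF unit_seq_in_car])
    then show ?case using Suc by simp
  qed
  have sum_u: "summable (\<lambda>k. norm (u k))" using u by (simp add: l1_car)
  have tail: "norm (\<psi> (t n) - \<psi> u) \<le> M * ((\<Sum>k. norm (u k)) - (\<Sum>k<n. norm (u k)))" for n
  proof -
    have d: "(\<lambda>k. u k - t n k) \<in> car (lp_space 1)" by (rule lp_diff_in_car[OF _ u t]) simp
    have "\<psi> u = \<psi> (\<lambda>k. u k - t n k) + \<psi> (t n)" using add[OF d t[of n]] by simp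
    then have "norm (\<psi> (t n) - \<psi> u) \<le> M * vnorm (lp_space 1) (\<lambda>k. u k - t n k)"
      using bound[OF d] by simp
    also have "vnorm (lp_space 1) (\<lambda>k. u k - t n k) = (\<Sum>k. norm (u k) - norm (t n k))"
      unfolding l1_vnorm[OF d] by (rule suminf_cong) (simp add: t_def)
    also have "\<dots> = (\<Sum>k. norm (u k)) - (\<Sum>k. norm (t n k))"
      using sum_u t[of n] by (simp add: suminf_diff l1_car)
    also have "(\<Sum>k. norm (t n k)) = (\<Sum>k<n. norm (t n k))"
      by (rule suminf_finite) (auto simp: t_def)
    also have "\<dots> = (\<Sum>k<n. norm (u k))" by (simp add: t_def)
    finally show ?thesis .
  qed
  have "(\<lambda>n. M * ((\<Sum>k. norm (u k)) - (\<Sum>k<n. norm (u k))))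
      \<longlonglongrightarrow> M * ((\<Sum>k. norm (u k)) - (\<Sum>k. norm (u k)))"
    by (intro tendsto_intros summable_LIMSEQ sum_u)
  then have "(\<lambda>n. M * ((\<Sum>k. norm (u k)) - (\<Sum>k<n. norm (u k)))) \<longlonglongrightarrow> 0" by simp
  then have "(\<lambda>n. \<psi> (t n) - \<psi> u) \<longlonglongrightarrow> 0"
    by (rule Lim_null_comparison[rotated]) (use tail in auto)
  then have "(\<lambda>k. u k * \<psi> (unit_seq k)) sums \<psi> u"
    unfolding sums_def psi_t[symmetric] by (rule LIM_zero_cancel)
  then show ?thesis by (rule sums_unique)
qed

text \<open>The zero functional shows that the supremum is taken over a nonempty set and is at least
  0.\<close>

lemma weak_norm_nonneg:
  assumes q: "q \<ge> 1" and r: "r \<ge> 1" and x: "\<And>j. j < m \<Longrightarrow> x j \<in> car (lp_space q)"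
  shows "weak_norm r (lp_space q) m (x :: nat \<Rightarrow> nat \<Rightarrow> 'k::real_normed_field) \<ge> 0"
proof -
  define \<psi> :: "(nat \<Rightarrow> 'k) \<Rightarrow> 'k" where "\<psi> = restrict (\<lambda>_. 0) (car (lp_space q))"
  have "continuous_map (norm_topology (lp_space q)) euclidean \<psi>"
    by (rule lp_bounded_imp_continuous[OF q, where M = 0]) (auto simp: \<psi>_def lp_add(1)[OF q])
  then have "\<psi> \<in> dual_ball (lp_space q)"
    by (auto simp: \<psi>_def dual_ball_def dual_space_def lp_simps lp_add(1)[OF q] lp_scale_in_car)
  from weak_norm_ge[OF q r x this] show ?thesis by (rule order.trans[rotated]) auto
qed

text \<open>A sequence bounded by 1 acts on \<open>\<ell>\<^sub>1\<close> as a functional in the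
  dual ball. This supplies the hypothesis \<open>hyp\<close> of \<open>diagonal_sum_le\<close>, with
  \<open>W\<close> the \<open>r\<close>-th power of the weak norm.\<close>

lemma weak_norm_l1_ge:
  fixes x :: "nat \<Rightarrow> nat \<Rightarrow> 'k::{real_normed_field,banach}"
  assumes r: "r \<ge> 1" and x: "\<And>j. j < m \<Longrightarrow> x j \<in> car (lp_space 1)"
    and z: "\<And>k. norm (z k) \<le> 1"
  shows "(\<Sum>j<m. norm (\<Sum>k. x j k * z k) powr r) \<le> weak_norm r (lp_space 1) m x powr r"
proof -
  have summ: "summable (\<lambda>k. u k * z k)" if "u \<in> car (lp_space 1)" for u
    using summable_mult_bounded[of u z 1] that z by (simp add: l1_car)
  have "(\<Sum>j<m. norm (\<Sum>k. x j k * z k) powr r) \<le> 1 powr r * weak_norm r (lp_space 1) m x powr r"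
  proof (rule sum_functional_le_weak_norm[where \<phi> = "\<lambda>u. \<Sum>k. u k * z k"])
    fix u v :: "nat \<Rightarrow> 'k" and c
    assume u: "u \<in> car (lp_space 1)"
    show "(\<Sum>k. c * u k * z k) = c * (\<Sum>k. u k * z k)"
      by (simp add: mult.assoc suminf_mult[OF summ[OF u]])
    have le: "norm (u k * z k) \<le> norm (u k)" for k
      using z[of k] by (simp add: norm_mult mult_left_le)
    have abs: "summable (\<lambda>k. norm (u k * z k))"
      by (rule summable_comparison_test'[where g = "\<lambda>k. norm (u k)" and N = 0])
        (use u le in \<open>auto simp: l1_car\<close>)
    have "norm (\<Sum>k. u k * z k) \<le> (\<Sum>k. norm (u k * z k))" by (rule summable_norm[OF abs])
    also have "\<dots> \<le> (\<Sum>k. norm (u k))" using u le abs by (intro suminf_le) (auto simp: l1_car)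
    finally show "norm (\<Sum>k. u k * z k) \<le> 1 * vnorm (lp_space 1) u" by (simp add: l1_vnorm[OF u])
    assume "v \<in> car (lp_space 1)"
    then show "(\<Sum>k. (u k + v k) * z k) = (\<Sum>k. u k * z k) + (\<Sum>k. v k * z k)"
      using suminf_add[OF summ[OF u] summ] by (simp add: distrib_right)
  qed (use r x in auto)
  then show ?thesis by simp
qed

section \<open>Continuous forms: boundedness and summability\<close>

context
  fixes A :: "(nat \<Rightarrow> nat \<Rightarrow> 'k::{real_normed_field,banach,real_inner}) \<Rightarrow> 'k"
    and n :: nat and q :: "nat \<Rightarrow> real"
  assumes q: "\<And>i. q i \<ge> 1" and n: "n > 0"
    and A: "A \<in> multilinear_forms n (\<lambda>i. lp_space (q i))"
begin

abbreviation "args \<equiv> (\<Pi>\<^sub>E i\<in>{..<n}. car (lp_space (q i)))"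

lemma form_add:
  assumes "x \<in> args" "i < n" "u \<in> car (lp_space (q i))" "v \<in> car (lp_space (q i))"
  shows "A (x(i := \<lambda>k. u k + v k)) = A (x(i := u)) + A (x(i := v))"
  using A assms unfolding multilinear_forms_def lp_simps by blast

lemma form_scale:
  assumes "x \<in> args" "i < n" "u \<in> car (lp_space (q i))"
  shows "A (x(i := \<lambda>k. c * u k)) = c * A (x(i := u))"
  using A assms unfolding multilinear_forms_def lp_simps by blast

lemma form_zero:
  assumes "x \<in> args" "i < n" "x i = (\<lambda>k. 0)"
  shows "A x = 0"
proof -
  have "x i \<in> car (lp_space (q i))" using assms(1,2) by auto
  moreover have "x(i := \<lambda>k. 0 * x i k) = x" using assms(3) by auto
  ultimately show ?thesis using form_scale[OF assms(1,2), of "x i" 0] by simp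
qed

text \<open>Induction on the number \<open>l\<close> of arguments already scaled. The case
  \<open>l = n\<close> normalises all arguments at once in \<open>form_bounded\<close>.\<close>

lemma form_scale_all:
  fixes c :: "nat \<Rightarrow> 'k"
  assumes x: "x \<in> args" and "l \<le> n"
  defines "y \<equiv> \<lambda>l i. if i < l then (\<lambda>k. c i * x i k) else x i"
  shows "y l \<in> args \<and> A (y l) = (\<Prod>i<l. c i) * A x"
  using \<open>l \<le> n\<close>
proof (induction l)
  case 0
  have "y 0 = x" by (simp add: y_def)
  then show ?case using x by simp
next
  case (Suc l)
  then have IH: "y l \<in> args" "A (y l) = (\<Prod>i<l. c i) * A x" and l: "l < n" by auto
  have xl: "x l \<in> car (lp_space (q l))" using x l by auto
  have upd: "y (Suc l) = (y l)(l := \<lambda>k. c l * x l k)" and same: "(y l)(l := x l) = y l"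
    by (auto simp: y_def fun_eq_iff less_Suc_eq)
  have "y (Suc l) \<in> args"
    unfolding upd using IH(1) l lp_scale_in_car[OF xl] by (auto simp: PiE_iff extensional_def)
  moreover have "A (y (Suc l)) = c l * A (y l)"
    unfolding upd form_scale[OF IH(1) l xl] same ..
  ultimately show ?case by (simp add: IH(2))
qed

lemma form_bounded_near_zero:
  "\<exists>d>0. \<forall>x\<in>args. (\<forall>i<n. vnorm (lp_space (q i)) (x i) < d) \<longrightarrow> norm (A x) < 1"
proof -
  define T :: "(nat \<Rightarrow> nat \<Rightarrow> 'k) topology"
    where "T = product_topology (\<lambda>i. norm_topology (lp_space (q i))) {..<n}"
  \<comment> \<open>The origin has to be restricted to the index set in order to be a point of the
    extensional product.\<close>
  define o' :: "nat \<Rightarrow> nat \<Rightarrow> 'k" where "o' = (\<lambda>i\<in>{..<n}. \<lambda>k. 0)"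
  have zero_car: "(\<lambda>k. 0) \<in> car (lp_space (q i) :: ('k, nat \<Rightarrow> 'k) nspace)" for i
    by (rule lp_finite_support_in_car[of "{}"]) auto
  have o: "o' \<in> args" by (auto simp: o'_def zero_car)
  have topT: "topspace T = args" by (simp add: T_def topspace_lp[OF q])
  have "continuous_map T euclidean A" using A by (simp add: multilinear_forms_def T_def)
  then have "openin T {x \<in> topspace T. A x \<in> ball 0 1}"
    by (rule openin_continuous_map_preimage) simp
  moreover have "o' \<in> {x \<in> topspace T. A x \<in> ball 0 1}"
    using o form_zero[OF o n] n by (simp add: topT) (simp add: o'_def)
  ultimately obtain U where U: "\<And>i. i < n \<Longrightarrow> openin (norm_topology (lp_space (q i))) (U i)"
    and oU: "o' \<in> PiE {..<n} U" and sub: "PiE {..<n} U \<subseteq> {x \<in> topspace T. A x \<in> ball 0 1}"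
    unfolding T_def openin_product_topology_alt by (metis (no_types, lifting) lessThan_iff)
  have "\<exists>d>0. \<forall>y\<in>car (lp_space (q i)). vnorm (lp_space (q i)) y < d \<longrightarrow> y \<in> U i" if i: "i < n" for i
  proof -
    have "(\<lambda>k. 0) \<in> U i" using oU i by (auto simp: o'_def PiE_iff)
    with U[OF i] have "\<exists>d>0. \<forall>y\<in>car (lp_space (q i)). vnorm (lp_space (q i)) (\<lambda>k. 0 - y k) < d \<longrightarrow> y \<in> U i"
      unfolding openin_lp[OF q] by (rule bspec[OF conjunct2])
    then obtain d where "d > 0" "\<forall>y\<in>car (lp_space (q i)). vnorm (lp_space (q i)) (\<lambda>k. 0 - y k) < d \<longrightarrow> y \<in> U i"
      by (elim exE conjE)
    then show ?thesis by (intro exI[of _ d]) (simp add: lp_vnorm)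
  qed
  then obtain d where d: "\<And>i. i < n \<Longrightarrow> d i > 0"
    and dU: "\<And>i y. i < n \<Longrightarrow> y \<in> car (lp_space (q i)) \<Longrightarrow> vnorm (lp_space (q i)) y < d i \<Longrightarrow> y \<in> U i"
    by metis
  \<comment> \<open>\<open>n > 0\<close> makes the minimum one over a nonempty set.\<close>
  have "0 < Min (d ` {..<n})" using d n by (subst Min_gr_iff) auto
  moreover have "norm (A x) < 1"
    if x: "x \<in> args" and small: "\<forall>i<n. vnorm (lp_space (q i)) (x i) < Min (d ` {..<n})" for x
  proof -
    have "x i \<in> U i" if i: "i < n" for i
    proof (rule dU[OF i])
      show "x i \<in> car (lp_space (q i))" using x i by auto
      show "vnorm (lp_space (q i)) (x i) < d i"
        using small i by (auto intro: less_le_trans)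
    qed
    then have "x \<in> PiE {..<n} U" using x by (auto simp: PiE_iff)
    then show ?thesis using sub by auto
  qed
  ultimately show ?thesis by blast
qed

text \<open>Every nonzero argument is rescaled to norm \<open>d / 2\<close>, where the form is below
  1; undoing the scalings gives the constant \<open>(2 / d)^n\<close>. If some argument is zero, so
  is the value of the form.\<close>

lemma form_bounded:
  "\<exists>M>0. \<forall>x\<in>args. norm (A x) \<le> M * (\<Prod>i<n. vnorm (lp_space (q i)) (x i))"
proof -
  obtain d where d: "d > 0"
    and small: "\<And>x. x \<in> args \<Longrightarrow> (\<And>i. i < n \<Longrightarrow> vnorm (lp_space (q i)) (x i) < d) \<Longrightarrow> norm (A x) < 1"
    using form_bounded_near_zero by blast
  have "norm (A x) \<le> (2 / d)^n * (\<Prod>i<n. vnorm (lp_space (q i)) (x i))" if x: "x \<in> args" for x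
  proof -
    define v where "v i = vnorm (lp_space (q i)) (x i)" for i
    have xi: "x i \<in> car (lp_space (q i))" if "i < n" for i using x that by auto
    show ?thesis
    proof (cases "\<exists>i<n. v i = 0")
      case True
      then have "A x = 0" using form_zero[OF x] lp_vnorm_eq_0_iff[OF q xi] by (auto simp: v_def)
      then show ?thesis using d by (auto intro!: mult_nonneg_nonneg prod_nonneg lp_vnorm_nonneg)
    next
      case False
      then have v: "v i > 0" if "i < n" for i
        using that lp_vnorm_nonneg[of "q i" "x i"] by (force simp: v_def less_le)
      define c where "c i = d / (2 * v i)" for i
      define y where "y i = (if i < n then (\<lambda>k. of_real (c i) * x i k) else x i)" for i
      have y: "y \<in> args" "A y = (\<Prod>i<n. of_real (c i)) * A x"
        using form_scale_all[OF x order.refl, of "\<lambda>i. of_real (c i)"] by (simp_all add: y_def[abs_def])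
      have "vnorm (lp_space (q i)) (y i) < d" if i: "i < n" for i
        using v[OF i] d i lp_vnorm_scale[OF q xi[OF i], of "of_real (c i)"]
        by (simp add: y_def c_def v_def[symmetric] norm_divide norm_mult)
      from small[OF y(1) this] have "norm (A y) < 1" .
      moreover have "norm (\<Prod>i<n. of_real (c i) :: 'k) = (\<Prod>i<n. c i)"
        unfolding prod_norm[symmetric] norm_of_real
        by (intro prod.cong refl abs_of_pos) (use v d in \<open>simp add: c_def\<close>)
      ultimately have "(\<Prod>i<n. c i) * norm (A x) < 1" by (simp add: y(2) norm_mult)
      moreover have "(\<Prod>i<n. c i) * ((2 / d)^n * (\<Prod>i<n. v i)) = 1"
      proof -
        have "(\<Prod>i<n. c i) * ((2 / d)^n * (\<Prod>i<n. v i)) = (\<Prod>i<n. c i * ((2 / d) * v i))"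
          by (simp only: prod.distrib prod_constant card_lessThan)
        also have "\<dots> = 1" by (intro prod.neutral ballI) (use v d in \<open>force simp: c_def\<close>)
        finally show ?thesis .
      qed
      moreover have "(\<Prod>i<n. c i) > 0" using v d by (intro prod_pos) (auto simp: c_def)
      ultimately show ?thesis
        unfolding v_def[symmetric] by (metis less_eq_real_def mult_less_cancel_left_pos)
    qed
  qed
  moreover have "(2 / d)^n > 0" using d by simp
  ultimately show ?thesis by blast
qed

lemma form_bounded_coordinate:
  assumes M: "\<And>x. x \<in> args \<Longrightarrow> norm (A x) \<le> M * (\<Prod>i<n. vnorm (lp_space (q i)) (x i))"
    and y: "y \<in> args" and i: "i < n" and u: "u \<in> car (lp_space (q i))"
  shows "norm (A (y(i := u)))
    \<le> M * (\<Prod>l\<in>{..<n} - {i}. vnorm (lp_space (q l)) (y l)) * vnorm (lp_space (q i)) u"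
proof -
  have "y(i := u) \<in> args" using y i u by (auto simp: PiE_iff extensional_def)
  from M[OF this] show ?thesis
    using i by (simp add: prod.remove[of "{..<n}" i] mult_ac)
qed

text \<open>
  The first \<open>n - Suc d\<close> arguments are held at unit vectors, uniformly in the choice \<open>\<kappa>\<close> of these;
  \<open>diagonal_sum_le\<close> frees one of them at a time.
\<close>

lemma sum_form_le:
  assumes r: "1 \<le> r" "r \<le> 2" and q1: "\<And>i. Suc i < n \<Longrightarrow> q i = 1"
    and M0: "M > 0" and M: "\<And>x. x \<in> args \<Longrightarrow> norm (A x) \<le> M * (\<Prod>i<n. vnorm (lp_space (q i)) (x i))"
    and x: "\<And>j. j < m \<Longrightarrow> x j \<in> args" and "d < n"
  defines "w \<equiv> \<lambda>i. weak_norm r (lp_space (q i)) m (\<lambda>j. x j i)"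
  shows "(\<Sum>j<m. norm (A (\<lambda>i. if i < n - Suc d then unit_seq (\<kappa> i) else x j i)) powr r)
    \<le> M powr r * 524288 ^ d * (\<Prod>i\<in>{n - Suc d..<n}. w i powr r)"
  using \<open>d < n\<close>
proof (induction d arbitrary: \<kappa>)
  case 0
  define N where "N = n - 1"
  have N: "N < n" "n - Suc 0 = N" using n by (auto simp: N_def)
  \<comment> \<open>Only the last argument, with index \<open>N = n - 1\<close>, is free here, and
    the zero sequence is a placeholder for it. The other arguments do not depend on
    \<open>j\<close>, so a single functional acts on all \<open>x j N\<close>.\<close>
  define b :: "nat \<Rightarrow> nat \<Rightarrow> 'k"
    where "b = (\<lambda>i\<in>{..<n}. if i < N then unit_seq (\<kappa> i) else (\<lambda>k. 0))"
  have zero_car: "(\<lambda>k. 0) \<in> car (lp_space (q i) :: ('k, nat \<Rightarrow> 'k) nspace)" for i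
    by (rule lp_finite_support_in_car[of "{}"]) auto
  have b: "b \<in> args" by (auto simp: b_def unit_seq_in_car zero_car)
  have eq: "(\<lambda>i. if i < N then unit_seq (\<kappa> i) else x j i) = b(N := x j N)" if "j < m" for j
  proof
    fix i
    show "(if i < N then unit_seq (\<kappa> i) else x j i) = (b(N := x j N)) i"
      using N PiE_arb[OF x[OF that], of i] by (cases i N rule: linorder_cases) (auto simp: b_def)
  qed
  have "(\<Sum>j<m. norm (A (b(N := x j N))) powr r) \<le> M powr r * w N powr r"
    unfolding w_def
  proof (rule sum_functional_le_weak_norm[OF q r(1), where \<phi> = "\<lambda>u. A (b(N := u))"])
    show "x j N \<in> car (lp_space (q N))" if "j < m" for j using x[OF that] N by auto
    fix u v :: "nat \<Rightarrow> 'k" and c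
    assume u: "u \<in> car (lp_space (q N))"
    show "A (b(N := \<lambda>k. c * u k)) = c * A (b(N := u))" by (rule form_scale[OF b N(1) u])
    \<comment> \<open>Unit vectors have norm 1, so the functional is bounded by \<open>M\<close>
      whatever \<open>\<kappa>\<close> is.\<close>
    have "(\<Prod>l\<in>{..<n} - {N}. vnorm (lp_space (q l)) (b l)) = 1"
      by (rule prod.neutral) (auto simp: b_def N_def vnorm_unit_seq)
    then show "norm (A (b(N := u))) \<le> M * vnorm (lp_space (q N)) u"
      using form_bounded_coordinate[OF M b N(1) u] by simp
    assume v: "v \<in> car (lp_space (q N))"
    show "A (b(N := \<lambda>k. u k + v k)) = A (b(N := u)) + A (b(N := v))"
      by (rule form_add[OF b N(1) u v])
  qed (rule M0)
  moreover have "{N..<n} = {N}" using N by auto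
  ultimately show ?case unfolding N(2) by (simp add: eq)
next
  case (Suc d)
  \<comment> \<open>\<open>l\<close> is the argument freed in this step: the induction hypothesis
    still holds it at a unit vector.\<close>
  define l where "l = n - Suc (Suc d)"
  have l: "l < n" "n - Suc d = Suc l" "q l = 1" using Suc.prems q1 by (auto simp: l_def)
  define y where "y j = (\<lambda>i. if i < l then unit_seq (\<kappa> i) else x j i)" for j
  define z where "z j k = A ((y j)(l := unit_seq k))" for j k
  have y: "y j \<in> args" if "j < m" for j
    using x[OF that] l(1) by (auto simp: y_def PiE_iff extensional_def unit_seq_in_car)
  have xl: "x j l \<in> car (lp_space 1)" if "j < m" for j
    using x[OF that] l by (metis PiE_mem lessThan_iff)
  have expand: "A (y j) = (\<Sum>k. x j l k * z j k)" if j: "j < m" for j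
  proof -
    have "A ((y j)(l := x j l)) = (\<Sum>k. x j l k * A ((y j)(l := unit_seq k)))"
      by (rule l1_functional_expansion[where \<psi> = "\<lambda>u. A ((y j)(l := u))", OF _ _ _ xl[OF j]])
        (use form_add[OF y[OF j] l(1)] form_scale[OF y[OF j] l(1)]
          form_bounded_coordinate[OF M y[OF j] l(1)] l(3) in auto)
    moreover have "(y j)(l := x j l) = y j" by (auto simp: y_def)
    ultimately show ?thesis by (simp add: z_def)
  qed
  have "(\<Sum>j<m. norm (\<Sum>k. x j l k * z j k) powr r)
      \<le> 524288 * w l powr r * (M powr r * 524288 ^ d * (\<Prod>i\<in>{Suc l..<n}. w i powr r))"
  proof (rule diagonal_sum_le[OF r])
    show "summable (\<lambda>k. norm (x j l k))" if "j < m" for j using xl[OF that] by (simp add: l1_car)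
    show "(\<Sum>j<m. norm (\<Sum>k. x j l k * u k) powr r) \<le> w l powr r" if "\<And>k. norm (u k) \<le> 1" for u
      using weak_norm_l1_ge[OF r(1), of m "\<lambda>j. x j l" u] xl that by (simp add: w_def l(3))
    fix k
    \<comment> \<open>Placing the unit vector \<open>k\<close> in argument \<open>l\<close> amounts
      to changing \<open>\<kappa>\<close> at \<open>l\<close>. The induction hypothesis for
      arbitrary \<open>\<kappa>\<close> thus bounds the sums over \<open>j\<close> uniformly in
      \<open>k\<close>, as \<open>diagonal_sum_le\<close> demands.\<close>
    have "(y j)(l := unit_seq k) = (\<lambda>i. if i < Suc l then unit_seq ((\<kappa>(l := k)) i) else x j i)" for j
      by (auto simp: y_def fun_eq_iff less_Suc_eq)
    then show "(\<Sum>j<m. norm (z j k) powr r) \<le> M powr r * 524288 ^ d * (\<Prod>i\<in>{Suc l..<n}. w i powr r)"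
      using Suc.IH[of "\<kappa>(l := k)"] Suc.prems by (simp add: z_def l(2))
  qed
  also have "\<dots> = M powr r * 524288 ^ Suc d * (\<Prod>i\<in>{l..<n}. w i powr r)"
    using l(1) by (simp add: prod.atLeast_Suc_lessThan)
  finally show ?case unfolding l_def[symmetric] y_def[symmetric] by (simp add: expand)
qed

text \<open>For \<open>d = n - 1\<close> no argument is held at a unit vector in
  \<open>sum_form_le\<close>. Each of the \<open>n - 1\<close> freed arguments has cost a factor
  524288, and \<open>K\<close> is the \<open>r\<close>-th root of their product.\<close>

lemma form_summing:
  assumes r: "1 \<le> r" "r \<le> 2" and q1: "\<And>i. Suc i < n \<Longrightarrow> q i = 1"
  shows "A \<in> summing_forms r (\<lambda>i. r) n (\<lambda>i. lp_space (q i))"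
proof -
  obtain M where M0: "M > 0"
    and M: "\<And>x. x \<in> args \<Longrightarrow> norm (A x) \<le> M * (\<Prod>i<n. vnorm (lp_space (q i)) (x i))"
    using form_bounded by blast
  define K :: real where "K = (524288 ^ (n - 1)) powr (1 / r)"
  have "(\<Sum>j<m. norm (A (x j)) powr r) powr (1 / r)
      \<le> M * K * (\<Prod>i<n. weak_norm r (lp_space (q i)) m (\<lambda>j. x j i))"
    if x: "\<forall>j<m. x j \<in> args" for m x
  proof -
    define w where "w i = weak_norm r (lp_space (q i)) m (\<lambda>j. x j i)" for i
    have w: "w i \<ge> 0" if "i < n" for i
      unfolding w_def by (rule weak_norm_nonneg[OF q r(1)]) (use x that in auto)
    have "(\<Sum>j<m. norm (A (x j)) powr r) \<le> M powr r * 524288 ^ (n - 1) * (\<Prod>i<n. w i powr r)"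
      using sum_form_le[OF r q1 M0 M, of m x "n - 1"] x n by (simp add: w_def atLeast0LessThan)
    then have "(\<Sum>j<m. norm (A (x j)) powr r) powr (1 / r)
        \<le> (M powr r * 524288 ^ (n - 1) * (\<Prod>i<n. w i powr r)) powr (1 / r)"
      using r by (intro powr_mono2 sum_nonneg) auto
    also have "\<dots> = M * K * (\<Prod>i<n. w i)"
      using r M0 w by (simp add: powr_mult prod_powr_distrib powr_powr K_def)
    finally show ?thesis by (simp add: w_def)
  qed
  moreover have "M * K > 0" using M0 by (simp add: K_def)
  ultimately show ?thesis using A unfolding summing_forms_def by blast
qed

end

text \<open>One inclusion is part of the definition of \<open>summing_forms\<close>, the other is
  \<open>form_summing\<close>. The sort of \<open>'k\<close> is shared by \<open>real\<close> and
  \<open>complex\<close>.\<close>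

lemma l1_lp_family_forms_eq:
  assumes "n > 0" "1 \<le> p" "1 \<le> r" "r \<le> 2"
  shows "multilinear_forms n (l1_lp_family n p ::
      nat \<Rightarrow> ('k::{real_normed_field,banach,real_inner}, nat \<Rightarrow> 'k) nspace)
    = summing_forms r (\<lambda>i. r) n (l1_lp_family n p)"
proof -
  have "(l1_lp_family n p :: nat \<Rightarrow> ('k, nat \<Rightarrow> 'k) nspace)
      = (\<lambda>i. lp_space (if i < n - 1 then 1 else p))"
    by (auto simp: l1_lp_family_def)
  moreover have "A \<in> summing_forms r (\<lambda>i. r) n (\<lambda>i. lp_space (if i < n - 1 then 1 else p))"
    if "A \<in> multilinear_forms n (\<lambda>i. lp_space (if i < n - 1 then 1 else p))"
    for A :: "(nat \<Rightarrow> nat \<Rightarrow> 'k) \<Rightarrow> 'k"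
    by (rule form_summing[OF _ assms(1) that assms(3,4)]) (use assms(2) in auto)
  moreover have "summing_forms r (\<lambda>i. r) n E \<subseteq> multilinear_forms n E"
    for E :: "nat \<Rightarrow> ('k, nat \<Rightarrow> 'k) nspace"
    by (auto simp: summing_forms_def)
  ultimately show ?thesis by auto
qed

theorem proposition4p6:
  fixes n :: nat and p r :: real
  assumes "n \<ge> 2" and "1 < p" and "p \<le> 2"
    and "1 \<le> r" and "r \<le> 2 ^ (n - 1) / (2 ^ (n - 1) - 1)"
  shows "multilinear_forms n (l1_lp_family n p :: nat \<Rightarrow> (real, nat \<Rightarrow> real) nspace)
           = summing_forms r (\<lambda>i. r) n (l1_lp_family n p) \<and>
         multilinear_forms n (l1_lp_family n p :: nat \<Rightarrow> (complex, nat \<Rightarrow> complex) nspace)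
           = summing_forms r (\<lambda>i. r) n (l1_lp_family n p)"
proof -
  \<comment> \<open>As \<open>n \<ge> 2\<close>, the number \<open>t = 2 ^ (n - 1)\<close> is at
    least 2, so \<open>t / (t - 1) \<le> 2\<close> and \<open>r\<close> lies in the range already
    covered.\<close>
  have "(2::real) ^ 1 \<le> 2 ^ (n - 1)" using assms(1) by (intro power_increasing) auto
  then have "2 ^ (n - 1) / (2 ^ (n - 1) - 1) \<le> (2::real)" by (simp add: field_simps)
  then have "r \<le> 2" using assms(5) by linarith
  then show ?thesis using assms by (intro conjI l1_lp_family_forms_eq) auto
qed

end
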